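(* Let $F_n:\mathbb{D}\to\mathbb{D}$, $n\in\mathbb{N}$, be a sequence of holomorphic self-maps of the unit disc $\mathbb{D}$ and suppose that there exists $z_0\in\mathbb{D}$ such that \[ \sum_{n=1}^{\infty}\bigl(1-|F_n(z_0)|\bigr)<\infty . \] Then almost all points of $\partial\mathbb{D}$ (with respect to Lebesgue measure) belong to the Denjoy--Wolff set of $(F_n)$.
   Context: For $\zeta\in\partial\mathbb{D}$, $F_n(\zeta)$ denotes the radial limit $\lim_{r\to1^-}F_n(r\zeta)$ wherever it exists (by Fatou's theorem this is the case for almost every $\zeta\in\partial\mathbb{D}$); its value lies in $\overline{\mathbb{D}}$. For a sequence $F_n:U\to U_n$ of holomorphic maps between simply connected domains such that $\operatorname{dist}(F_n(z),\partial U_n)\to0$ as $n\to\infty$ for all $z\in U$ (here $U=U_n=\mathbb{D}$), the Denjoy--Wolff set of $(F_n)$ is the set of $\zeta\in\partial U$ (at which the boundary values $F_n(\zeta)$ are defined) such that, for all $z\in U$, $|F_n(\zeta)-F_n(z)|\to0$ as $n\to\infty$. *)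

theory Defs
  imports "HOL-Complex_Analysis.Complex_Analysis"
begin

text \<open>Arc length on the unit circle. Almost-everywhere statements do not distinguish this Borel
  measure from its completion.\<close>

definition circle_measure :: "complex measure" where
  "circle_measure =
     distr (restrict_space lborel {0..<2 * pi}) (restrict_space borel (sphere 0 1)) cis"

definition has_radial_limit :: "(complex \<Rightarrow> complex) \<Rightarrow> complex \<Rightarrow> complex \<Rightarrow> bool" where
  "has_radial_limit f \<zeta> l \<longleftrightarrow> ((\<lambda>r::real. f (of_real r * \<zeta>)) \<longlongrightarrow> l) (at_left 1)"

text \<open>Meaningful only where the limit exists.\<close>

definition radial_limit :: "(complex \<Rightarrow> complex) \<Rightarrow> complex \<Rightarrow> complex" where
  "radial_limit f \<zeta> = (THE l. has_radial_limit f \<zeta> l)"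

definition tends_to_boundary :: "(nat \<Rightarrow> complex \<Rightarrow> complex) \<Rightarrow> bool" where
  "tends_to_boundary F \<longleftrightarrow>
     (\<forall>z \<in> ball 0 1. (\<lambda>n. infdist (F n z) (sphere 0 1)) \<longlonglongrightarrow> 0)"

text \<open>The notion presupposes that the orbits \<open>F n z\<close> tend to the boundary of the disc. This
  requirement is part of the definition, so the set is empty for a sequence that violates it.\<close>

definition denjoy_wolff_set :: "(nat \<Rightarrow> complex \<Rightarrow> complex) \<Rightarrow> complex set" where
  "denjoy_wolff_set F =
     {\<zeta> \<in> sphere 0 1. tends_to_boundary F \<and> (\<forall>n. \<exists>l. has_radial_limit (F n) \<zeta> l) \<and>
        (\<forall>z \<in> ball 0 1. (\<lambda>n. norm (radial_limit (F n) \<zeta> - F n z)) \<longlonglongrightarrow> 0)}"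

end

theory Submission
  imports Defs
begin

text \<open>Everything rests on the Poisson integral on the circle. With \<open>p\<close> the normalized Poisson kernel and
  \<open>F\<^sup>*\<close> the radial boundary function of a holomorphic self-map \<open>F\<close> of the disc, the variance identity
  and Fatou's lemma give \<open>\<integral> p(z\<^sub>0, \<zeta>) |F\<^sup>*(\<zeta>) - F(z\<^sub>0)|\<^sup>2 \<le> 1 - |F(z\<^sub>0)|\<^sup>2\<close>. Summing over
  the sequence, the series of the \<open>|F\<^sub>n\<^sup>*(\<zeta>) - F\<^sub>n(z\<^sub>0)|\<^sup>2\<close> converges for almost every \<open>\<zeta>\<close>, and
  the same variance bounds \<open>|F\<^sub>n(z) - F\<^sub>n(z\<^sub>0)|\<^sup>2\<close> for every fixed \<open>z\<close>. Radial limits exist almost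
  everywhere because Taylor polynomials converge in \<open>H\<^sup>2\<close> and the radial maximal function is
  bounded on \<open>H\<^sup>2\<close>; the maximal inequality follows from a \<open>T T\<^sup>*\<close> argument, without covering
  lemmas.\<close>

section \<open>The Poisson integral on the circle\<close>

text \<open>The kernel at \<open>z\<close> is a probability density on the circle under which a
  holomorphic function has mean equal to its value at \<open>z\<close>. For a self-map the second
  moment is at most 1, so the variance is at most \<open>2 (1 - |F(z)|)\<close>: the hypothesis says
  that the variances are summable, and almost sure convergence follows in the manner of
  Borel-Cantelli. Comparing the kernels at two points, the same inequality takes the place of the
  Schwarz-Pick lemma. The costly ingredient is the existence of radial limits. A maximal operator is
  not linear, so a measurable radius \<open>r(a)\<close> is chosen at each boundary point
  \<open>a\<close>, which gives a linear operator \<open>T\<close>. By the semigroup law, the kernel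
  of \<open>T T\<^sup>*\<close> is the Poisson kernel of radius \<open>r(a) r(b)\<close>, and this
  is controlled by the kernel of the smaller of the two radii.\<close>

definition poisson :: "complex \<Rightarrow> complex \<Rightarrow> real" where
  "poisson z w = (1 - (norm z)\<^sup>2) / (2 * pi * (norm (w - z))\<^sup>2)"

section \<open>Arc length on the circle and contour integrals\<close>

lemma space_circle_measure [simp]: "space circle_measure = sphere 0 1"
  by (simp add: circle_measure_def space_restrict_space)

lemma sets_circle_measure [measurable_cong]:
  "sets circle_measure = sets (restrict_space borel (sphere 0 1))"
  by (simp add: circle_measure_def)

lemma cis_measurable_circle [measurable]:
  "cis \<in> restrict_space lborel {0..<2 * pi} \<rightarrow>\<^sub>M restrict_space borel (sphere 0 1)"
proof (rule measurable_restrict_space2)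
  have "cis \<in> borel_measurable borel"
    by (intro borel_measurable_continuous_onI continuous_intros)
  then show "cis \<in> borel_measurable (restrict_space lborel {0..<2 * pi})"
    by (intro measurable_restrict_space1) simp
qed simp

lemma circle_measure_ident [measurable]: "(\<lambda>x. x) \<in> circle_measure \<rightarrow>\<^sub>M borel"
  by (subst measurable_cong_sets[OF sets_circle_measure refl])
    (intro measurable_restrict_space1 measurable_ident_sets refl)

lemma emeasure_space_circle: "emeasure circle_measure (sphere 0 1) = 2 * pi"
proof -
  have "emeasure circle_measure (sphere 0 1)
      = emeasure (restrict_space lborel {0..<2 * pi}) (cis -` sphere 0 1 \<inter> {0..<2 * pi})"
    unfolding circle_measure_def
    by (subst emeasure_distr) (auto simp: space_restrict_space sets_restrict_space)
  also have "cis -` sphere 0 1 \<inter> {0..<2 * pi} = {0..<2 * pi}"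
    by auto
  also have "emeasure (restrict_space lborel {0..<2 * pi}) {0..<2 * pi} = 2 * pi"
    by (subst emeasure_restrict_space) auto
  finally show ?thesis .
qed

lemma finite_measure_circle: "finite_measure circle_measure"
  by (rule finite_measureI) (simp add: emeasure_space_circle)

interpretation circle: finite_measure circle_measure
  by (rule finite_measure_circle)

interpretation circle_pair: pair_sigma_finite circle_measure circle_measure
  by unfold_locales

lemma AE_circle_norm: "AE w in circle_measure. norm w = 1"
  by (rule AE_I2) simp

lemma continuous_circle_measurable:
  fixes f :: "complex \<Rightarrow> 'b::topological_space"
  assumes "continuous_on (sphere 0 1) f"
  shows "f \<in> borel_measurable circle_measure"
  using borel_measurable_continuous_on_restrict[OF assms] measurable_cong_sets[OF sets_circle_measure refl]
  by blast

lemma continuous_circle_integrable: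
  fixes f :: "complex \<Rightarrow> 'b::{banach, second_countable_topology}"
  assumes "continuous_on (sphere 0 1) f"
  shows "integrable circle_measure f"
proof -
  have "compact (f ` sphere 0 1)"
    using assms by (rule compact_continuous_image) simp
  then obtain B where B: "\<And>w. norm w = 1 \<Longrightarrow> norm (f w) \<le> B"
    using compact_imp_bounded bounded_iff by (metis imageI mem_sphere_0)
  show ?thesis
    using AE_circle_norm
    by (intro circle.integrable_const_bound[of f B] continuous_circle_measurable assms)
      (auto elim!: eventually_mono intro: B)
qed

text \<open>For \<open>w = cis t\<close> the path has derivative \<open>\<i> * w\<close>, so this
  factor turns arc length into \<open>dw\<close>. The half-open parameter interval of the measure
  differs from that of the contour by a null set.\<close>

lemma circle_integral_eq_contour:
  assumes cont: "continuous_on (sphere 0 1) f"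
    and I: "(f has_contour_integral I) (circlepath 0 1)"
  shows "(\<integral>w. f w * (\<i> * w) \<partial>circle_measure) = I"
proof -
  define g where "g = (\<lambda>t. f (cis t) * (\<i> * cis t))"
  have contg: "continuous_on UNIV g"
    unfolding g_def
    by (intro continuous_intros continuous_on_compose2[OF cont]) auto
  have fcont: "continuous_on (sphere 0 1) (\<lambda>w. f w * (\<i> * w))"
    by (intro continuous_intros cont)
  have meas: "(\<lambda>w. f w * (\<i> * w)) \<in> borel_measurable (restrict_space borel (sphere 0 1))"
    using borel_measurable_continuous_on_restrict[OF fcont] .
  have "(\<integral>w. f w * (\<i> * w) \<partial>circle_measure) = integral\<^sup>L (restrict_space lborel {0..<2*pi}) g"
    unfolding circle_measure_def g_def by (rule integral_distr[OF cis_measurable_circle meas])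
  also have "\<dots> = (LINT t:{0..<2*pi}|lborel. g t)"
    by (subst integral_restrict_space) (auto simp: set_lebesgue_integral_def)
  also have "\<dots> = (LINT t:{0..2*pi}|lborel. g t)"
  proof (rule set_integral_cong_set)
    have gm: "g \<in> borel_measurable borel"
      using contg by (rule borel_measurable_continuous_onI)
    show "set_borel_measurable lborel {0..<2*pi} g" "set_borel_measurable lborel {0..2*pi} g"
      using gm by (auto simp: set_borel_measurable_def)
    have "AE x in lborel. x \<noteq> 2*pi"
      by (rule AE_lborel_singleton)
    then show "AE x in lborel. (x \<in> {0..2*pi}) = (x \<in> {0..<2*pi})"
      by eventually_elim auto
  qed
  also have "\<dots> = integral {0..2*pi} g"
    by (intro set_borel_integral_eq_integral borel_integrable_compact continuous_on_subset[OF contg])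
       (auto simp: set_integrable_def intro!: borel_integrable_compact continuous_on_subset[OF contg])
  also have "\<dots> = I"
  proof -
    have "((\<lambda>t. f (0 + of_real 1 * cis t) * of_real 1 * \<i> * cis t) has_integral I) {0..2*pi}"
      using I unfolding circlepath_def
      by (subst (asm) has_contour_integral_part_circlepath_iff) auto
    then show ?thesis
      by (intro integral_unique) (simp add: g_def mult.assoc)
  qed
  finally show ?thesis .
qed

section \<open>Reproducing formula, semigroup law and size of the Poisson kernel\<close>

lemma poisson_nonneg: "norm z \<le> 1 \<Longrightarrow> 0 \<le> poisson z w"
  by (simp add: poisson_def abs_square_le_1)

lemma continuous_poisson: "norm z < 1 \<Longrightarrow> continuous_on (sphere 0 1) (poisson z)"
  unfolding poisson_def by (intro continuous_intros) auto

lemma poisson_formula: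
  assumes h: "h holomorphic_on cball 0 1" and z: "norm z < 1"
  shows "(\<integral>w. poisson z w *\<^sub>R h w \<partial>circle_measure) = h z"
proof -
  define c where "c = complex_of_real (1 - (norm z)\<^sup>2)"
  \<comment> \<open>Cauchy's formula is applied to \<open>g\<close> instead of \<open>h\<close>: the
    extra factor equals 1 at \<open>z\<close>, and on the circle
    \<open>1 - cnj z * w = w * cnj (w - z)\<close>, which turns the Cauchy kernel into the Poisson
    kernel.\<close>
  define g where "g = (\<lambda>w. h w * c / (1 - cnj z * w))"
  have ne: "1 - cnj z * w \<noteq> 0" if "norm w \<le> 1" for w
  proof
    assume "1 - cnj z * w = 0"
    then have "norm (cnj z * w) = 1" by (metis eq_iff_diff_eq_0 norm_one)
    then have "norm z * norm w = 1" by (simp add: norm_mult)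
    moreover have "norm z * norm w \<le> norm z * 1" by (rule mult_left_mono) (use that in auto)
    ultimately show False using z by simp
  qed
  have g: "g holomorphic_on cball 0 1"
    unfolding g_def by (intro holomorphic_intros h) (use ne in auto)
  have gz: "g z = h z"
  proof -
    have "1 - cnj z * z = c"
      unfolding c_def by (simp add: complex_norm_square mult.commute del: of_real_power)
    then show ?thesis using ne[of z] z by (simp add: g_def)
  qed
  have "((\<lambda>w. g w / (w - z)) has_contour_integral (2 * of_real pi * \<i> * g z)) (circlepath 0 1)"
    by (rule Cauchy_integral_circlepath_simple[OF g]) (use z in simp)
  then have "(\<integral>w. g w / (w - z) * (\<i> * w) \<partial>circle_measure) = 2 * of_real pi * \<i> * g z"
  proof (rule circle_integral_eq_contour[rotated])
    show "continuous_on (sphere 0 1) (\<lambda>w. g w / (w - z))"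
      by (intro continuous_intros holomorphic_on_imp_continuous_on holomorphic_on_subset[OF g])
         (use z in auto)
  qed
  moreover have "(\<integral>w. g w / (w - z) * (\<i> * w) \<partial>circle_measure)
     = (\<integral>w. (2 * pi * \<i>) * (poisson z w *\<^sub>R h w) \<partial>circle_measure)"
  proof (rule Bochner_Integration.integral_cong[OF refl])
    fix w assume "w \<in> space circle_measure"
    then have w: "norm w = 1" by simp
    then have w1: "w * cnj w = 1" by (simp add: complex_norm_square[symmetric])
    have wz: "w - z \<noteq> 0" using w z by auto
    have "complex_of_real ((norm (w - z))\<^sup>2) = (w - z) * (cnj w - cnj z)"
      by (simp add: complex_norm_square del: of_real_power)
    moreover have "(1 - cnj z * w) = w * (cnj w - cnj z)"
      using w1 by (simp add: algebra_simps)
    ultimately have eq: "(w - z) * (1 - cnj z * w) = w * complex_of_real ((norm (w - z))\<^sup>2)"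
      by (simp add: mult_ac)
    have w0: "w \<noteq> 0" using w by auto
    have n0: "complex_of_real ((norm (w - z))\<^sup>2) \<noteq> 0" using wz by simp
    have "g w / (w - z) * (\<i> * w) = h w * c * \<i> * w / ((w - z) * (1 - cnj z * w))"
      by (simp add: g_def mult_ac)
    also have "\<dots> = h w * c * \<i> / complex_of_real ((norm (w - z))\<^sup>2)"
      unfolding eq using w0 by simp
    also have "\<dots> = (2 * pi * \<i>) * (poisson z w *\<^sub>R h w)"
      unfolding poisson_def c_def scaleR_conv_of_real using n0
      by (simp add: field_simps del: of_real_power)
    finally show "g w / (w - z) * (\<i> * w) = (2 * pi * \<i>) * (poisson z w *\<^sub>R h w)" .
  qed
  moreover have "\<dots> = (2 * pi * \<i>) * (\<integral>w. poisson z w *\<^sub>R h w \<partial>circle_measure)"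
    by (rule integral_mult_right_zero)
  ultimately have "(2 * pi * \<i>) * (\<integral>w. poisson z w *\<^sub>R h w \<partial>circle_measure) = (2 * pi * \<i>) * h z"
    by (simp add: gz)
  then show ?thesis
    by simp
qed

text \<open>For fixed \<open>r\<close> the kernel depends only on the angle between the two boundary
  points.\<close>

lemma poisson_sym:
  assumes a: "norm a = 1" and b: "norm b = 1"
  shows "poisson (of_real r * a) b = poisson (of_real r * b) a"
proof -
  have expand: "(norm (y - of_real r * x))\<^sup>2
      = (norm y)\<^sup>2 + r\<^sup>2 * (norm x)\<^sup>2 - 2 * r * (Re x * Re y + Im x * Im y)" for x y
    unfolding cmod_power2 by (simp add: power2_eq_square algebra_simps)
  have "(norm (b - of_real r * a))\<^sup>2 = (norm (a - of_real r * b))\<^sup>2"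
    unfolding expand a b by (simp add: mult.commute)
  then show ?thesis
    by (simp add: poisson_def norm_mult a b)
qed

lemma poisson_semigroup:
  assumes a: "norm a = 1" and b: "norm b = 1" and r: "0 \<le> r" "r < 1" and s: "0 \<le> s" "s < 1"
  shows "(\<integral>t. poisson (of_real r * a) t * poisson (of_real s * b) t \<partial>circle_measure)
       = poisson (of_real (r * s) * a) b"
proof -
  \<comment> \<open>The Herglotz kernel. It is holomorphic on the closed disc because
    \<open>s < 1\<close>, and its real part on the circle is \<open>2 * pi\<close> times the Poisson
    kernel at \<open>s b\<close>; the reproducing formula at \<open>r a\<close> therefore evaluates
    the integral.\<close>
  define h where "h = (\<lambda>w. (b + of_real s * w) / (b - of_real s * w))"
  have ne: "b - of_real s * w \<noteq> 0" if "norm w \<le> 1" for w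
  proof
    assume "b - of_real s * w = 0"
    then have "norm (of_real s * w) = 1" using b by (metis eq_iff_diff_eq_0)
    then have "s * norm w = 1" using s by (simp add: norm_mult)
    moreover have "s * norm w \<le> s * 1" by (rule mult_left_mono) (use that s in auto)
    ultimately show False using s by simp
  qed
  have Reh: "Re (h w) = (1 - s\<^sup>2 * (norm w)\<^sup>2) / (norm (b - of_real s * w))\<^sup>2" for w
  proof -
    have "Re (h w) = Re ((b + of_real s * w) * cnj (b - of_real s * w)) / (norm (b - of_real s * w))\<^sup>2"
      unfolding h_def by (subst complex_div_cnj) simp
    also have "Re ((b + of_real s * w) * cnj (b - of_real s * w)) = (norm b)\<^sup>2 - s\<^sup>2 * (norm w)\<^sup>2"
      unfolding cmod_power2 by (simp add: algebra_simps power2_eq_square)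
    finally show ?thesis by (simp add: b)
  qed
  have holh: "h holomorphic_on cball 0 1"
    unfolding h_def by (intro holomorphic_intros) (use ne in auto)
  have ra: "norm (of_real r * a) < 1"
    using r a by (simp add: norm_mult)
  have "h (of_real r * a) = (\<integral>t. poisson (of_real r * a) t *\<^sub>R h t \<partial>circle_measure)"
    by (rule poisson_formula[symmetric, OF holh ra])
  moreover have int: "integrable circle_measure (\<lambda>t. poisson (of_real r * a) t *\<^sub>R h t)"
    by (intro continuous_circle_integrable continuous_intros continuous_poisson ra
        holomorphic_on_imp_continuous_on holomorphic_on_subset[OF holh]) auto
  ultimately have "Re (h (of_real r * a)) = (\<integral>t. Re (poisson (of_real r * a) t *\<^sub>R h t) \<partial>circle_measure)"
    using integral_Re[OF int] by simp
  also have "\<dots> = (\<integral>t. (2 * pi) * (poisson (of_real r * a) t * poisson (of_real s * b) t) \<partial>circle_measure)"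
  proof (rule Bochner_Integration.integral_cong[OF refl])
    fix t assume "t \<in> space circle_measure"
    then have t: "norm t = 1" by simp
    have "Re (h t) = 2 * pi * poisson (of_real s * t) b"
      unfolding Reh by (simp add: poisson_def t norm_mult)
    also have "\<dots> = 2 * pi * poisson (of_real s * b) t"
      by (simp add: poisson_sym[OF t b])
    finally show "Re (poisson (of_real r * a) t *\<^sub>R h t) =
        (2 * pi) * (poisson (of_real r * a) t * poisson (of_real s * b) t)" by simp
  qed
  also have "\<dots> = 2 * pi * (\<integral>t. poisson (of_real r * a) t * poisson (of_real s * b) t \<partial>circle_measure)"
    by simp
  finally have "2 * pi * (\<integral>t. poisson (of_real r * a) t * poisson (of_real s * b) t \<partial>circle_measure)
    = Re (h (of_real r * a))" ..
  also have "\<dots> = 2 * pi * poisson (of_real (r * s) * a) b"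
  proof -
    have "2 * pi * poisson (of_real (r * s) * a) b
        = (1 - (norm (of_real (r * s) * a))\<^sup>2) / (norm (b - of_real (r * s) * a))\<^sup>2"
      by (simp add: poisson_def)
    then show ?thesis
      unfolding Reh by (simp add: a norm_mult power_mult_distrib mult_ac)
  qed
  finally show ?thesis by simp
qed

text \<open>Since \<open>r\<^sup>2 \<le> r s \<le> r\<close>, the points \<open>r a\<close> and
  \<open>r s a\<close> are at comparable distance from the circle. The numerator grows by at most 2,
  as \<open>1 - r^4 \<le> 2 (1 - r\<^sup>2)\<close>, and the distance to \<open>b\<close> shrinks by
  at most 2, which costs 4 after squaring.\<close>

lemma poisson_le_of_radius_le:
  assumes a: "norm a = 1" and b: "norm b = 1" and r: "0 \<le> r" "r \<le> s" "s < 1"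
  shows "poisson (of_real (r * s) * a) b \<le> 8 * poisson (of_real r * a) b"
proof -
  have s: "0 \<le> s" using r by simp
  have rs: "r * s \<le> r" using r by (simp add: mult_left_le)
  have rs1: "r * s < 1" using r rs by linarith
  define x where "x = norm (b - of_real (r * s) * a)"
  define y where "y = norm (b - of_real r * a)"
  have x: "1 - r * s \<le> x"
    unfolding x_def using norm_triangle_ineq2[of b "of_real (r * s) * a"] a b r s
    by (simp add: norm_mult abs_mult)
  have "1 - r \<le> y"
    unfolding y_def using norm_triangle_ineq2[of b "of_real r * a"] a b r s
    by (simp add: norm_mult)
  then have y0: "0 < y" using r by linarith
  have "b - of_real r * a = (b - of_real (r * s) * a) - of_real (r * (1 - s)) * a"
    by (simp add: algebra_simps)
  then have "y \<le> x + norm (of_real (r * (1 - s)) * a)"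
    unfolding x_def y_def using norm_triangle_ineq4 by metis
  also have "norm (of_real (r * (1 - s)) * a) = r * (1 - s)"
    using r a by (simp only: norm_mult norm_of_real) simp
  finally have "y \<le> x + (r - r * s)" by (simp add: algebra_simps)
  then have "y \<le> 2 * x" using x r by linarith
  then have y4: "y\<^sup>2 \<le> 4 * x\<^sup>2"
    using power_mono[of y "2 * x" 2] y0 by (simp add: power_mult_distrib)
  have x0: "0 < x" using x rs1 by linarith
  have "1 - (r * s)\<^sup>2 \<le> 2 * (1 - r\<^sup>2)"
  proof -
    have "r * r \<le> r * s" using r by (simp add: mult_left_mono)
    then have "(r * r)\<^sup>2 \<le> (r * s)\<^sup>2" using r by (intro power_mono) auto
    moreover have "0 \<le> (1 - r * r)\<^sup>2" by simp
    ultimately show ?thesis unfolding power2_eq_square by (simp add: algebra_simps)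
  qed
  moreover have "0 \<le> 1 - r\<^sup>2" using r by (simp add: power_le_one)
  ultimately have "(1 - (r * s)\<^sup>2) * y\<^sup>2 \<le> (2 * (1 - r\<^sup>2)) * (4 * x\<^sup>2)"
    using y4 by (intro mult_mono) auto
  then have "(1 - (r * s)\<^sup>2) / x\<^sup>2 \<le> 8 * ((1 - r\<^sup>2) / y\<^sup>2)"
    using x0 y0 by (simp add: field_simps)
  then have "(1 - (r * s)\<^sup>2) / x\<^sup>2 / (2 * pi) \<le> 8 * ((1 - r\<^sup>2) / y\<^sup>2) / (2 * pi)"
    by (intro divide_right_mono) auto
  moreover have "poisson (of_real (r * s) * a) b = (1 - (r * s)\<^sup>2) / x\<^sup>2 / (2 * pi)"
    "poisson (of_real r * a) b = (1 - r\<^sup>2) / y\<^sup>2 / (2 * pi)"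
    unfolding poisson_def x_def y_def using r s
    by (simp_all only: norm_mult norm_of_real a mult_1_left mult_1_right power2_abs divide_divide_eq_left mult_ac)
  ultimately show ?thesis by simp
qed

lemma poisson_le:
  assumes "norm z \<le> R" "R < 1" "norm w = 1"
  shows "poisson z w \<le> 1 / (2 * pi * (1 - R)\<^sup>2)"
proof -
  have "1 - R \<le> norm (w - z)"
    using norm_triangle_ineq2[of w z] assms by simp
  then have "(1 - R)\<^sup>2 \<le> (norm (w - z))\<^sup>2"
    using assms by (intro power_mono) auto
  then show ?thesis
    unfolding poisson_def using assms by (intro frac_le mult_left_mono mult_pos_pos) auto
qed

text \<open>Together with the upper bound this gives a crude Harnack inequality between two interior
  points; it also shows that the weight at a fixed point never vanishes on the circle.\<close>

lemma poisson_ge: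
  assumes "norm z < 1" "norm w = 1"
  shows "(1 - (norm z)\<^sup>2) / (8 * pi) \<le> poisson z w"
proof -
  have "norm (w - z) \<le> 2"
    using norm_triangle_ineq4[of w z] assms by simp
  then have "(norm (w - z))\<^sup>2 \<le> 2\<^sup>2"
    by (intro power_mono) auto
  moreover have "0 < norm (w - z)" using assms by auto
  moreover have "0 \<le> 1 - (norm z)\<^sup>2" using assms by (simp add: power_le_one)
  ultimately show ?thesis
    unfolding poisson_def by (intro frac_le) auto
qed

lemma ennreal_power2_le_imp_le:
  fixes x y :: ennreal
  assumes "x\<^sup>2 \<le> y\<^sup>2"
  shows "x \<le> y"
proof (cases "y = top")
  case False
  then obtain b where b: "y = ennreal b" "0 \<le> b" by (cases y) auto
  have "x \<noteq> top"
    using assms b by (auto simp: ennreal_power top_unique)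
  then obtain a where a: "x = ennreal a" "0 \<le> a" by (cases x) auto
  show ?thesis
    using assms a b by (auto simp: ennreal_power intro!: ennreal_leI power2_le_imp_le)
qed simp

section \<open>The radial maximal inequality\<close>

text \<open>The radius \<open>r a\<close> varies with the boundary point: this linearizes the maximal function.\<close>

definition poisson_ext :: "(complex \<Rightarrow> real) \<Rightarrow> (complex \<Rightarrow> ennreal) \<Rightarrow> complex \<Rightarrow> ennreal" where
  "poisson_ext r u a = (\<integral>\<^sup>+ w. ennreal (poisson (of_real (r a) * a) w) * u w \<partial>circle_measure)"

section \<open>The linearized maximal operator \<open>T\<close> and its adjoint\<close>

context
  fixes r :: "complex \<Rightarrow> real"
  assumes r [measurable]: "r \<in> borel_measurable circle_measure"
    and r0: "\<And>a. 0 \<le> r a" and r1: "\<And>a. r a < 1"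
begin

lemma measurable_poisson_radius [measurable]:
  "(\<lambda>(a, w). ennreal (poisson (of_real (r a) * a) w))
     \<in> borel_measurable (circle_measure \<Otimes>\<^sub>M circle_measure)"
  unfolding poisson_def by measurable

lemma measurable_poisson_ext [measurable]:
  assumes [measurable]: "u \<in> borel_measurable circle_measure"
  shows "poisson_ext r u \<in> borel_measurable circle_measure"
  unfolding poisson_ext_def by measurable

text \<open>The left side is the kernel of \<open>T T\<^sup>*\<close> at \<open>(a, b)\<close>,
  which by the semigroup law is a single Poisson kernel. Which of the two radii is smaller depends
  on the points; bounding by the sum of both cases produces the kernels of \<open>T\<close> and of
  \<open>T\<^sup>*\<close> without a case distinction.\<close>

lemma poisson_radius_composition:
  assumes a: "norm a = 1" and b: "norm b = 1"
  shows "(\<integral>\<^sup>+ t. ennreal (poisson (of_real (r a) * a) t) * ennreal (poisson (of_real (r b) * b) t) \<partial>circle_measure)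
       \<le> 8 * (ennreal (poisson (of_real (r a) * a) b) + ennreal (poisson (of_real (r b) * b) a))"
proof -
  have ra: "norm (of_real (r a) * a) < 1" and rb: "norm (of_real (r b) * b) < 1"
    using a b r0 r1 by (simp_all add: norm_mult)
  have nn: "0 \<le> poisson (of_real (r a) * a) t" "0 \<le> poisson (of_real (r b) * b) t" for t
    using ra rb by (simp_all add: poisson_nonneg)
  have "(\<integral>\<^sup>+ t. ennreal (poisson (of_real (r a) * a) t) * ennreal (poisson (of_real (r b) * b) t) \<partial>circle_measure)
      = (\<integral>\<^sup>+ t. ennreal (poisson (of_real (r a) * a) t * poisson (of_real (r b) * b) t) \<partial>circle_measure)"
    using nn by (simp add: ennreal_mult)
  also have "\<dots> = ennreal (\<integral>t. poisson (of_real (r a) * a) t * poisson (of_real (r b) * b) t \<partial>circle_measure)"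
    by (intro nn_integral_eq_integral continuous_circle_integrable continuous_intros continuous_poisson ra rb)
       (use nn in auto)
  also have "\<dots> = ennreal (poisson (of_real (r a * r b) * a) b)"
    by (subst poisson_semigroup) (use a b r0 r1 in auto)
  also have "\<dots> \<le> ennreal (8 * (poisson (of_real (r a) * a) b + poisson (of_real (r b) * b) a))"
  proof (rule ennreal_leI, cases "r a \<le> r b")
    case True
    then show "poisson (of_real (r a * r b) * a) b
      \<le> 8 * (poisson (of_real (r a) * a) b + poisson (of_real (r b) * b) a)"
      using poisson_le_of_radius_le[OF a b r0 True r1] nn(2)[of a]
      by (simp add: distrib_left add_increasing2)
  next
    case False
    then have "r b \<le> r a" by simp
    then show "poisson (of_real (r a * r b) * a) b
      \<le> 8 * (poisson (of_real (r a) * a) b + poisson (of_real (r b) * b) a)"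
      using poisson_le_of_radius_le[OF b a r0 _ r1, of b a] nn(1)[of b]
        poisson_sym[OF a b, of "r a * r b"]
      by (simp add: mult.commute[of "r b"] distrib_left add_increasing del: of_real_mult)
  qed
  also have "\<dots> = 8 * (ennreal (poisson (of_real (r a) * a) b) + ennreal (poisson (of_real (r b) * b) a))"
    using nn by (simp add: ennreal_mult ennreal_plus)
  finally show ?thesis .
qed

text \<open>The duality \<open><v, T u> = <u, T\<^sup>* v>\<close>. Extended nonnegative values let
  Tonelli's theorem apply with no integrability condition.\<close>

lemma poisson_ext_adjoint:
  assumes [measurable]: "u \<in> borel_measurable circle_measure" "v \<in> borel_measurable circle_measure"
  shows "(\<integral>\<^sup>+ a. v a * poisson_ext r u a \<partial>circle_measure)
    = (\<integral>\<^sup>+ t. u t * (\<integral>\<^sup>+ a. ennreal (poisson (of_real (r a) * a) t) * v a \<partial>circle_measure) \<partial>circle_measure)"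
proof -
  have "(\<integral>\<^sup>+ a. v a * poisson_ext r u a \<partial>circle_measure)
     = (\<integral>\<^sup>+ a. \<integral>\<^sup>+ t. v a * (ennreal (poisson (of_real (r a) * a) t) * u t) \<partial>circle_measure \<partial>circle_measure)"
    unfolding poisson_ext_def
    by (intro nn_integral_cong nn_integral_cmult[symmetric]) measurable
  also have "\<dots> = (\<integral>\<^sup>+ t. \<integral>\<^sup>+ a. v a * (ennreal (poisson (of_real (r a) * a) t) * u t) \<partial>circle_measure \<partial>circle_measure)"
    by (intro circle_pair.Fubini'[symmetric]) measurable
  also have "\<dots> = (\<integral>\<^sup>+ t. \<integral>\<^sup>+ a. u t * (ennreal (poisson (of_real (r a) * a) t) * v a) \<partial>circle_measure \<partial>circle_measure)"
    by (simp add: mult_ac)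
  also have "\<dots> = (\<integral>\<^sup>+ t. u t * (\<integral>\<^sup>+ a. ennreal (poisson (of_real (r a) * a) t) * v a \<partial>circle_measure) \<partial>circle_measure)"
    by (intro nn_integral_cong nn_integral_cmult) measurable
  finally show ?thesis .
qed

text \<open>The squared norm of \<open>T\<^sup>* v\<close> is \<open><v, T T\<^sup>* v>\<close>. The
  kernel bound gives 8 times the sum of \<open><v, T v>\<close> and \<open><v, T\<^sup>* v>\<close>,
  and these two pairings coincide, whence 16.\<close>

lemma poisson_ext_adjoint_norm:
  assumes [measurable]: "v \<in> borel_measurable circle_measure"
  shows "(\<integral>\<^sup>+ t. (\<integral>\<^sup>+ a. ennreal (poisson (of_real (r a) * a) t) * v a \<partial>circle_measure)\<^sup>2 \<partial>circle_measure)
     \<le> 16 * (\<integral>\<^sup>+ a. v a * poisson_ext r v a \<partial>circle_measure)"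
proof -
  define w where "w = (\<lambda>t. \<integral>\<^sup>+ a. ennreal (poisson (of_real (r a) * a) t) * v a \<partial>circle_measure)"
  have [measurable]: "w \<in> borel_measurable circle_measure"
    unfolding w_def by measurable
  have Tw: "poisson_ext r w a \<le> 8 * (poisson_ext r v a + w a)" if a: "norm a = 1" for a
  proof -
    have "poisson_ext r w a = (\<integral>\<^sup>+ t. \<integral>\<^sup>+ b. ennreal (poisson (of_real (r a) * a) t) *
        (ennreal (poisson (of_real (r b) * b) t) * v b) \<partial>circle_measure \<partial>circle_measure)"
      unfolding poisson_ext_def w_def
      by (intro nn_integral_cong nn_integral_cmult[symmetric]) measurable
    also have "\<dots> = (\<integral>\<^sup>+ b. \<integral>\<^sup>+ t. ennreal (poisson (of_real (r a) * a) t) *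
        (ennreal (poisson (of_real (r b) * b) t) * v b) \<partial>circle_measure \<partial>circle_measure)"
      unfolding poisson_def by (intro circle_pair.Fubini'[symmetric]) measurable
    also have "\<dots> = (\<integral>\<^sup>+ b. \<integral>\<^sup>+ t. v b * (ennreal (poisson (of_real (r a) * a) t) *
        ennreal (poisson (of_real (r b) * b) t)) \<partial>circle_measure \<partial>circle_measure)"
      by (simp add: mult_ac)
    also have "\<dots> = (\<integral>\<^sup>+ b. v b * (\<integral>\<^sup>+ t. (ennreal (poisson (of_real (r a) * a) t) *
        ennreal (poisson (of_real (r b) * b) t)) \<partial>circle_measure) \<partial>circle_measure)"
      unfolding poisson_def by (intro nn_integral_cong nn_integral_cmult) measurable
    also have "\<dots> \<le> (\<integral>\<^sup>+ b. v b * (8 * (ennreal (poisson (of_real (r a) * a) b)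
        + ennreal (poisson (of_real (r b) * b) a))) \<partial>circle_measure)"
      using a by (intro nn_integral_mono mult_left_mono poisson_radius_composition) auto
    also have "\<dots> = (\<integral>\<^sup>+ b. 8 * (ennreal (poisson (of_real (r a) * a) b) * v b
        + ennreal (poisson (of_real (r b) * b) a) * v b) \<partial>circle_measure)"
      by (simp add: algebra_simps)
    also have "\<dots> = 8 * (poisson_ext r v a + w a)"
      unfolding poisson_ext_def w_def poisson_def
      by (subst nn_integral_cmult) (measurable, subst nn_integral_add, measurable)
    finally show ?thesis .
  qed
  have "(\<integral>\<^sup>+ t. (w t)\<^sup>2 \<partial>circle_measure) = (\<integral>\<^sup>+ a. v a * poisson_ext r w a \<partial>circle_measure)"
  proof (subst poisson_ext_adjoint)
    have "(\<integral>\<^sup>+ a. ennreal (poisson (of_real (r a) * a) t) * v a \<partial>circle_measure) = w t" for t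
      by (simp add: w_def)
    then show "(\<integral>\<^sup>+ t. (w t)\<^sup>2 \<partial>circle_measure) = (\<integral>\<^sup>+ t. w t *
        (\<integral>\<^sup>+ a. ennreal (poisson (of_real (r a) * a) t) * v a \<partial>circle_measure) \<partial>circle_measure)"
      by (simp only: power2_eq_square)
  qed simp_all
  also have "\<dots> \<le> (\<integral>\<^sup>+ a. v a * (8 * (poisson_ext r v a + w a)) \<partial>circle_measure)"
    by (intro nn_integral_mono mult_left_mono Tw) auto
  also have "\<dots> = (\<integral>\<^sup>+ a. 8 * (v a * poisson_ext r v a + v a * w a) \<partial>circle_measure)"
    by (simp add: algebra_simps)
  also have "\<dots> = 8 * ((\<integral>\<^sup>+ a. v a * poisson_ext r v a \<partial>circle_measure) + (\<integral>\<^sup>+ a. v a * w a \<partial>circle_measure))"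
    by (subst nn_integral_cmult) (measurable, subst nn_integral_add, measurable)
  also have "(\<integral>\<^sup>+ a. v a * w a \<partial>circle_measure) = (\<integral>\<^sup>+ a. v a * poisson_ext r v a \<partial>circle_measure)"
    by (subst poisson_ext_adjoint) (auto simp: w_def)
  also have "8 * ((\<integral>\<^sup>+ a. v a * poisson_ext r v a \<partial>circle_measure) + (\<integral>\<^sup>+ a. v a * poisson_ext r v a \<partial>circle_measure))
    = 16 * (\<integral>\<^sup>+ a. v a * poisson_ext r v a \<partial>circle_measure)"
    by (metis (no_types, lifting) mult_2 mult.assoc numeral_times_numeral semiring_norm(11,12,13))
  finally show ?thesis unfolding w_def .
qed

text \<open>A bound \<open>B\<close> for the squared operator norm self-improves to \<open>16 \<surd>B\<close>, because \<open>T T\<^sup>*\<close> is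
  dominated by \<open>8 (T + T\<^sup>*)\<close>.\<close>

lemma poisson_ext_bound_step:
  assumes B: "0 < B"
    and bound: "\<And>u. u \<in> borel_measurable circle_measure \<Longrightarrow>
      (\<integral>\<^sup>+ a. (poisson_ext r u a)\<^sup>2 \<partial>circle_measure) \<le> ennreal B * (\<integral>\<^sup>+ a. (u a)\<^sup>2 \<partial>circle_measure)"
    and [measurable]: "u \<in> borel_measurable circle_measure"
  shows "(\<integral>\<^sup>+ a. (poisson_ext r u a)\<^sup>2 \<partial>circle_measure)
    \<le> ennreal (16 * sqrt B) * (\<integral>\<^sup>+ a. (u a)\<^sup>2 \<partial>circle_measure)"
proof -
  define v where "v = poisson_ext r u"
  have [measurable]: "v \<in> borel_measurable circle_measure"
    unfolding v_def by measurable
  define U where "U = (\<integral>\<^sup>+ a. (u a)\<^sup>2 \<partial>circle_measure)"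
  define V where "V = (\<integral>\<^sup>+ a. (v a)\<^sup>2 \<partial>circle_measure)"
  define w where "w = (\<lambda>t. \<integral>\<^sup>+ a. ennreal (poisson (of_real (r a) * a) t) * v a \<partial>circle_measure)"
  have [measurable]: "w \<in> borel_measurable circle_measure"
    unfolding w_def by measurable
  \<comment> \<open>Here \<open>v = T u\<close>. Cauchy-Schwarz and the assumed bound give
    \<open><v, T v> \<le> sqrt B * V\<close>. Since also \<open>V = <u, T\<^sup>* v>\<close>, it
    follows that \<open>V\<^sup>2 \<le> 16 U <v, T v>\<close>, and after cancelling one
    \<open>V\<close> only the root of \<open>B\<close> is left.\<close>
  have "(\<integral>\<^sup>+ a. v a * poisson_ext r v a \<partial>circle_measure)\<^sup>2
      \<le> V * (\<integral>\<^sup>+ a. (poisson_ext r v a)\<^sup>2 \<partial>circle_measure)"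
    unfolding V_def by (intro Cauchy_Schwarz_nn_integral) measurable
  also have "\<dots> \<le> V * (ennreal B * V)"
    unfolding V_def by (intro mult_left_mono bound) measurable
  also have "\<dots> = (ennreal (sqrt B) * V)\<^sup>2"
    using B by (simp add: power_mult_distrib ennreal_power power2_eq_square mult_ac)
      (simp add: ennreal_mult[symmetric] mult.assoc[symmetric])
  finally have vTv: "(\<integral>\<^sup>+ a. v a * poisson_ext r v a \<partial>circle_measure) \<le> ennreal (sqrt B) * V"
    by (rule ennreal_power2_le_imp_le)
  have "V = (\<integral>\<^sup>+ a. v a * poisson_ext r u a \<partial>circle_measure)"
    by (simp add: V_def v_def power2_eq_square)
  also have "\<dots> = (\<integral>\<^sup>+ t. u t * w t \<partial>circle_measure)"
    by (subst poisson_ext_adjoint) (auto simp: w_def)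
  finally have "V\<^sup>2 \<le> U * (\<integral>\<^sup>+ t. (w t)\<^sup>2 \<partial>circle_measure)"
    unfolding U_def by (simp add: Cauchy_Schwarz_nn_integral)
  also have "\<dots> \<le> U * (16 * (\<integral>\<^sup>+ a. v a * poisson_ext r v a \<partial>circle_measure))"
    unfolding w_def by (intro mult_left_mono poisson_ext_adjoint_norm) auto
  also have "\<dots> \<le> U * (16 * (ennreal (sqrt B) * V))"
    by (intro mult_left_mono vTv) auto
  also have "\<dots> = (ennreal (16 * sqrt B) * U) * V"
    using B by (simp add: ennreal_mult mult_ac)
  finally have main: "V * V \<le> (ennreal (16 * sqrt B) * U) * V"
    by (simp add: power2_eq_square)
  \<comment> \<open>The assumed bound enters again only to make \<open>V\<close> finite when
    \<open>U\<close> is, so that \<open>V\<close> may be cancelled.\<close>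
  have VB: "V \<le> ennreal B * U"
    unfolding V_def U_def v_def by (intro bound) measurable
  have "V \<le> ennreal (16 * sqrt B) * U"
  proof (cases "U = top")
    case True
    then show ?thesis using B by (simp add: ennreal_mult_top)
  next
    case False
    then have "V \<noteq> top"
      using VB by (metis ennreal_mult_eq_top_iff ennreal_neq_top top_unique)
    show ?thesis
    proof (cases "V = 0")
      case False
      then show ?thesis
        using main \<open>V \<noteq> top\<close>
        by (metis ennreal_mult_le_mult_iff mult.commute)
    qed simp
  qed
  then show ?thesis by (simp add: V_def U_def v_def)
qed

text \<open>The bound \<open>R\<close> serves to get some finite constant at all; the conclusion is
  uniform in \<open>R\<close>. Iterating \<open>B \<mapsto> 16 sqrt B\<close> drives any constant
  towards the fixed point 256, and the argument through the infimum trades a factor 2 for not having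
  to iterate.\<close>

lemma poisson_ext_bound:
  assumes R: "\<And>a. r a \<le> R" "R < 1" and u: "u \<in> borel_measurable circle_measure"
  shows "(\<integral>\<^sup>+ a. (poisson_ext r u a)\<^sup>2 \<partial>circle_measure) \<le> 513 * (\<integral>\<^sup>+ a. (u a)\<^sup>2 \<partial>circle_measure)"
proof -
  define S where "S = {B. 0 < B \<and> (\<forall>u. u \<in> borel_measurable circle_measure \<longrightarrow>
      (\<integral>\<^sup>+ a. (poisson_ext r u a)\<^sup>2 \<partial>circle_measure) \<le> ennreal B * (\<integral>\<^sup>+ a. (u a)\<^sup>2 \<partial>circle_measure))}"
  have step: "16 * sqrt B \<in> S" if "B \<in> S" for B
    using that poisson_ext_bound_step[of B] by (auto simp: S_def)
  define C where "C = 1 / (2 * pi * (1 - R)\<^sup>2)"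
  have C: "0 < C" using R by (simp add: C_def)
  \<comment> \<open>A starting constant, poor but finite: the kernel is at most \<open>C\<close>,
    one factor \<open>2 * pi\<close> comes from Cauchy-Schwarz against the function 1, the other
    from integrating the resulting constant over the circle.\<close>
  have "C\<^sup>2 * (2 * pi) * (2 * pi) \<in> S"
    unfolding S_def
  proof (intro CollectI conjI allI impI)
    fix u :: "complex \<Rightarrow> ennreal" assume [measurable]: "u \<in> borel_measurable circle_measure"
    define I where "I = (\<integral>\<^sup>+ w. u w \<partial>circle_measure)"
    have T: "poisson_ext r u a \<le> ennreal C * I" if a: "norm a = 1" for a
    proof -
      have "norm (of_real (r a) * a) \<le> R"
        using a R r0[of a] by (simp add: norm_mult)
      then have "poisson_ext r u a \<le> (\<integral>\<^sup>+ w. ennreal C * u w \<partial>circle_measure)"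
        unfolding poisson_ext_def C_def using R
        by (intro nn_integral_mono mult_right_mono ennreal_leI poisson_le) auto
      also have "\<dots> = ennreal C * I" unfolding I_def by (intro nn_integral_cmult) measurable
      finally show ?thesis .
    qed
    have "I\<^sup>2 \<le> (\<integral>\<^sup>+ w. (u w)\<^sup>2 \<partial>circle_measure) * (\<integral>\<^sup>+ w. 1\<^sup>2 \<partial>circle_measure)"
      using Cauchy_Schwarz_nn_integral[of u circle_measure "\<lambda>_. 1"] by (simp add: I_def)
    then have I2: "I\<^sup>2 \<le> (\<integral>\<^sup>+ w. (u w)\<^sup>2 \<partial>circle_measure) * ennreal (2 * pi)"
      by (simp add: emeasure_space_circle)
    have "(\<integral>\<^sup>+ a. (poisson_ext r u a)\<^sup>2 \<partial>circle_measure) \<le> (\<integral>\<^sup>+ a. (ennreal C * I)\<^sup>2 \<partial>circle_measure)"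
      by (intro nn_integral_mono power_mono T) auto
    also have "\<dots> = ennreal (C\<^sup>2) * I\<^sup>2 * ennreal (2 * pi)"
      using C by (simp add: emeasure_space_circle power_mult_distrib ennreal_power)
    also have "\<dots> \<le> ennreal (C\<^sup>2) * ((\<integral>\<^sup>+ w. (u w)\<^sup>2 \<partial>circle_measure) * ennreal (2 * pi)) * ennreal (2 * pi)"
      by (intro mult_right_mono mult_left_mono I2) auto
    also have "\<dots> = ennreal (C\<^sup>2 * (2 * pi) * (2 * pi)) * (\<integral>\<^sup>+ w. (u w)\<^sup>2 \<partial>circle_measure)"
      by (simp add: ennreal_mult mult_ac)
    finally show "(\<integral>\<^sup>+ a. (poisson_ext r u a)\<^sup>2 \<partial>circle_measure)
      \<le> ennreal (C\<^sup>2 * (2 * pi) * (2 * pi)) * (\<integral>\<^sup>+ w. (u w)\<^sup>2 \<partial>circle_measure)" .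
  qed (use C in simp)
  then have ne: "S \<noteq> {}" by auto
  have bdd: "bdd_below S" by (rule bdd_belowI[of _ 0]) (auto simp: S_def)
  \<comment> \<open>The infimum need not be attained, so an element below \<open>2 * Inf S\<close>
    is taken; the step then gives \<open>(Inf S)\<^sup>2 \<le> 256 B < 512 Inf S\<close>. The value
    513 leaves room to pick an element of \<open>S\<close> again.\<close>
  have "Inf S \<le> 512"
  proof (rule ccontr)
    assume "\<not> Inf S \<le> 512"
    then have b: "Inf S > 512" by simp
    then have "Inf S < 2 * Inf S" by simp
    then obtain B where B: "B \<in> S" "B < 2 * Inf S"
      using cInf_lessD[OF ne] by blast
    have "Inf S \<le> 16 * sqrt B"
      using step[OF B(1)] bdd by (rule cInf_lower)
    then have "(Inf S)\<^sup>2 \<le> (16 * sqrt B)\<^sup>2" using b by (intro power_mono) auto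
    also have "\<dots> = 256 * B" using B(1) by (simp add: S_def power_mult_distrib)
    also have "\<dots> < 512 * Inf S" using B(2) by simp
    also have "\<dots> < Inf S * Inf S" using b by simp
    finally show False by (simp add: power2_eq_square)
  qed
  then have "Inf S < 513" by simp
  then obtain B where B: "B \<in> S" "B < 513"
    using cInf_lessD[OF ne] by blast
  then have "(\<integral>\<^sup>+ a. (poisson_ext r u a)\<^sup>2 \<partial>circle_measure) \<le> ennreal B * (\<integral>\<^sup>+ a. (u a)\<^sup>2 \<partial>circle_measure)"
    using u by (auto simp: S_def)
  also have "\<dots> \<le> ennreal 513 * (\<integral>\<^sup>+ a. (u a)\<^sup>2 \<partial>circle_measure)"
    using B by (intro mult_right_mono ennreal_leI) auto
  finally show ?thesis by simp
qed

end

section \<open>From the operator \<open>T\<close> to maximal functions of holomorphic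
  functions\<close>

lemma norm_le_poisson_integral:
  assumes h: "h holomorphic_on cball 0 1" and z: "norm z < 1"
  shows "ennreal (norm (h z)) \<le> (\<integral>\<^sup>+ w. ennreal (poisson z w) * ennreal (norm (h w)) \<partial>circle_measure)"
proof -
  have "continuous_on (sphere 0 1) (\<lambda>w. poisson z w *\<^sub>R h w)"
    by (intro continuous_intros continuous_poisson z
        holomorphic_on_imp_continuous_on holomorphic_on_subset[OF h]) auto
  then have int: "integrable circle_measure (\<lambda>w. poisson z w *\<^sub>R h w)"
    by (rule continuous_circle_integrable)
  have "ennreal (norm (h z)) = ennreal (norm (\<integral>w. poisson z w *\<^sub>R h w \<partial>circle_measure))"
    by (simp add: poisson_formula h z)
  also have "\<dots> \<le> (\<integral>\<^sup>+ w. norm (poisson z w *\<^sub>R h w) \<partial>circle_measure)"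
    using integral_norm_bound_ennreal[OF int] by simp
  also have "\<dots> = (\<integral>\<^sup>+ w. ennreal (poisson z w) * ennreal (norm (h w)) \<partial>circle_measure)"
    using z by (intro nn_integral_cong) (simp add: poisson_nonneg ennreal_mult)
  finally show ?thesis .
qed

lemma holomorphic_on_dilation:
  assumes "h holomorphic_on ball 0 1" "0 \<le> \<sigma>" "\<sigma> < 1"
  shows "(\<lambda>w. h (of_real \<sigma> * w)) holomorphic_on cball 0 1"
proof -
  have "norm (of_real \<sigma> * w) < 1" if "norm w \<le> 1" for w :: complex
  proof -
    have "\<sigma> * norm w \<le> \<sigma> * 1" using that assms by (intro mult_left_mono) auto
    then show ?thesis using assms by (simp add: norm_mult)
  qed
  then have "h \<circ> (\<lambda>w. of_real \<sigma> * w) holomorphic_on cball 0 1"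
    by (intro holomorphic_on_compose_gen[OF _ assms(1)] holomorphic_intros) auto
  then show ?thesis by (simp add: o_def)
qed

lemma measurable_dilation:
  assumes "h holomorphic_on ball 0 1" "0 \<le> \<sigma>" "\<sigma> < 1"
  shows "(\<lambda>w. h (of_real \<sigma> * w)) \<in> borel_measurable circle_measure"
  by (intro continuous_circle_measurable holomorphic_on_imp_continuous_on
      holomorphic_on_subset[OF holomorphic_on_dilation[OF assms]]) auto

text \<open>The index function \<open>k\<close> chooses the radius at each boundary point. Its bound
  \<open>N\<close> keeps the radii away from 1, but does not enter the constant.\<close>

lemma linearized_maximal_bound:
  fixes q :: "nat \<Rightarrow> real"
  assumes h: "h holomorphic_on ball 0 1"
    and K: "\<And>\<sigma>. 0 \<le> \<sigma> \<Longrightarrow> \<sigma> < 1 \<Longrightarrow>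
      (\<integral>\<^sup>+ a. (ennreal (norm (h (of_real \<sigma> * a))))\<^sup>2 \<partial>circle_measure) \<le> K"
    and q: "\<And>i. 0 \<le> q i" "\<And>i. q i < 1"
    and k [measurable]: "k \<in> circle_measure \<rightarrow>\<^sub>M count_space UNIV" and kN: "\<And>a. k a \<le> N"
  shows "(\<integral>\<^sup>+ a. (ennreal (norm (h (of_real (q (k a)) * a))))\<^sup>2 \<partial>circle_measure) \<le> 513 * K"
proof -
  define m where "m = Max (q ` {..N})"
  have m_ge: "q i \<le> m" if "i \<le> N" for i unfolding m_def using that by (intro Max_ge) auto
  have "m \<in> q ` {..N}" unfolding m_def by (intro Max_in) auto
  then have m: "0 \<le> m" "m < 1" using q by auto
  \<comment> \<open>Any number strictly between \<open>m\<close> and 1 would do: the dilate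
    \<open>g\<close> is then holomorphic on the closed disc, and the rescaled radii stay below
    \<open>m / \<sigma> < 1\<close>.\<close>
  define \<sigma> where "\<sigma> = (1 + m) / 2"
  have \<sigma>: "0 < \<sigma>" "\<sigma> < 1" "m < \<sigma>" using m by (auto simp: \<sigma>_def)
  define g where "g = (\<lambda>w. h (of_real \<sigma> * w))"
  have g: "g holomorphic_on cball 0 1"
    unfolding g_def using h \<sigma> by (intro holomorphic_on_dilation) auto
  have gm [measurable]: "g \<in> borel_measurable circle_measure"
    unfolding g_def using h \<sigma> by (intro measurable_dilation) auto
  define r where "r = (\<lambda>a. q (k a) / \<sigma>)"
  have [measurable]: "r \<in> borel_measurable circle_measure"
    unfolding r_def by (intro borel_measurable_divide measurable_compose[OF k]) auto
  have r0: "0 \<le> r a" for a using q \<sigma> by (simp add: r_def)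
  have rR: "r a \<le> m / \<sigma>" for a
    unfolding r_def using m_ge[OF kN] \<sigma> by (intro divide_right_mono) auto
  have R: "m / \<sigma> < 1" using \<sigma> by simp
  have r1: "r a < 1" for a using rR[of a] R by simp
  have "(\<integral>\<^sup>+ a. (ennreal (norm (h (of_real (q (k a)) * a))))\<^sup>2 \<partial>circle_measure)
     \<le> (\<integral>\<^sup>+ a. (poisson_ext r (\<lambda>w. ennreal (norm (g w))) a)\<^sup>2 \<partial>circle_measure)"
  proof (intro nn_integral_mono power_mono)
    fix a assume "a \<in> space circle_measure"
    then have a: "norm a = 1" by simp
    have "h (of_real (q (k a)) * a) = g (of_real (r a) * a)"
      using \<sigma> by (simp add: g_def r_def)
    then show "ennreal (norm (h (of_real (q (k a)) * a))) \<le> poisson_ext r (\<lambda>w. ennreal (norm (g w))) a"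
      unfolding poisson_ext_def
      using norm_le_poisson_integral[OF g, of "of_real (r a) * a"] a r0 r1 by (simp add: norm_mult)
  qed simp
  also have "\<dots> \<le> 513 * (\<integral>\<^sup>+ a. (ennreal (norm (g a)))\<^sup>2 \<partial>circle_measure)"
    using r0 r1 rR R by (intro poisson_ext_bound[where R = "m / \<sigma>"]) auto
  also have "\<dots> \<le> 513 * K"
    unfolding g_def using \<sigma> by (intro mult_left_mono K) auto
  finally show ?thesis .
qed

theorem radial_maximal_inequality:
  fixes q :: "nat \<Rightarrow> real"
  assumes h: "h holomorphic_on ball 0 1"
    and K: "\<And>\<sigma>. 0 \<le> \<sigma> \<Longrightarrow> \<sigma> < 1 \<Longrightarrow>
      (\<integral>\<^sup>+ a. (ennreal (norm (h (of_real \<sigma> * a))))\<^sup>2 \<partial>circle_measure) \<le> K"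
    and q: "\<And>i. 0 \<le> q i" "\<And>i. q i < 1"
  shows "(\<integral>\<^sup>+ a. (SUP i. (ennreal (norm (h (of_real (q i) * a))))\<^sup>2) \<partial>circle_measure) \<le> 513 * K"
proof -
  define x where "x = (\<lambda>i a. (ennreal (norm (h (of_real (q i) * a))))\<^sup>2)"
  have [measurable]: "x i \<in> borel_measurable circle_measure" for i
    using measurable_dilation[OF h q(1)[of i] q(2)[of i]] unfolding x_def by measurable
  define F where "F = (\<lambda>N a. SUP i\<in>{..N::nat}. x i a)"
  have FK: "integral\<^sup>N circle_measure (F N) \<le> 513 * K" for N
  proof -
    \<comment> \<open>Choosing the least maximizing index makes the selection measurable.\<close>
    define k where "k = (\<lambda>a. LEAST i. i \<le> N \<and> (\<forall>j\<in>{..N}. x j a \<le> x i a))"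
    have [measurable]: "k \<in> circle_measure \<rightarrow>\<^sub>M count_space UNIV"
      unfolding k_def by measurable
    have k: "k a \<le> N \<and> (\<forall>j\<in>{..N}. x j a \<le> x (k a) a)" for a
    proof -
      have "Max ((\<lambda>i. x i a) ` {..N}) \<in> (\<lambda>i. x i a) ` {..N}" by (intro Max_in) auto
      then obtain i where i: "i \<le> N" "Max ((\<lambda>i. x i a) ` {..N}) = x i a"
        by (metis (no_types, lifting) atMost_iff imageE)
      have "\<forall>j\<in>{..N}. x j a \<le> x i a" unfolding i(2)[symmetric] by (intro ballI Max_ge) auto
      with i(1) have "i \<le> N \<and> (\<forall>j\<in>{..N}. x j a \<le> x i a)" by simp
      then show ?thesis unfolding k_def by (rule LeastI)
    qed
    have "integral\<^sup>N circle_measure (F N) \<le> (\<integral>\<^sup>+ a. x (k a) a \<partial>circle_measure)"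
      unfolding F_def using k by (intro nn_integral_mono SUP_least) auto
    also have "\<dots> \<le> 513 * K"
      unfolding x_def using k by (intro linearized_maximal_bound[OF h K q, where N = N]) auto
    finally show ?thesis .
  qed
  have SUPF: "(SUP i. x i a) = (SUP N. F N a)" for a
    unfolding F_def by (intro antisym SUP_least) (auto intro: SUP_upper2)
  have "(\<integral>\<^sup>+ a. (SUP i. x i a) \<partial>circle_measure) = (\<integral>\<^sup>+ a. (SUP N. F N a) \<partial>circle_measure)"
    unfolding SUPF ..
  also have "\<dots> = (SUP N. integral\<^sup>N circle_measure (F N))"
  proof (rule nn_integral_monotone_convergence_SUP)
    show "incseq F"
      unfolding F_def by (intro monoI le_funI SUP_subset_mono) auto
    show "F i \<in> borel_measurable circle_measure" for i
      unfolding F_def by measurable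
  qed
  also have "\<dots> \<le> 513 * K"
    by (intro SUP_least FK)
  finally show ?thesis by (simp add: x_def)
qed

section \<open>Square-summable Taylor coefficients and Fatou's theorem\<close>

lemma circle_integral_power: "(\<integral>w. w ^ n \<partial>circle_measure) = (if n = 0 then 2 * pi else 0)"
proof -
  have "(\<integral>w. poisson 0 w *\<^sub>R w ^ n \<partial>circle_measure) = 0 ^ n"
    by (intro poisson_formula holomorphic_intros) auto
  moreover have "(\<integral>w. poisson 0 w *\<^sub>R w ^ n \<partial>circle_measure) = (\<integral>w. (1 / (2 * pi)) *\<^sub>R w ^ n \<partial>circle_measure)"
    by (intro Bochner_Integration.integral_cong) (auto simp: poisson_def)
  ultimately show ?thesis
    by (auto simp: power_0_left scaleR_conv_of_real field_simps split: if_splits)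
qed

lemma circle_integral_power_cnj:
  "(\<integral>w. w ^ n * cnj (w ^ m) \<partial>circle_measure) = (if n = m then 2 * pi else 0)"
proof -
  have ge: "(\<integral>w. w ^ n * cnj (w ^ m) \<partial>circle_measure) = (if n = m then 2 * pi else 0)" if "m \<le> n" for n m
  proof -
    have "w ^ n * cnj (w ^ m) = w ^ (n - m)" if w: "norm w = 1" for w
    proof -
      have "w ^ n * cnj (w ^ m) = w ^ (n - m) * (w ^ m * cnj (w ^ m))"
        using \<open>m \<le> n\<close> by (simp add: mult.assoc[symmetric] power_add[symmetric] del: complex_cnj_power)
      also have "w ^ m * cnj (w ^ m) = 1"
        using w by (simp add: complex_norm_square[symmetric] norm_power del: complex_cnj_power)
      finally show ?thesis by simp
    qed
    then have "(\<integral>w. w ^ n * cnj (w ^ m) \<partial>circle_measure) = (\<integral>w. w ^ (n - m) \<partial>circle_measure)"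
      by (intro Bochner_Integration.integral_cong) auto
    then show ?thesis using that by (auto simp: circle_integral_power)
  qed
  show ?thesis
  proof (cases "m \<le> n")
    case False
    have "(\<integral>w. w ^ n * cnj (w ^ m) \<partial>circle_measure) = (\<integral>w. cnj (w ^ m * cnj (w ^ n)) \<partial>circle_measure)"
      by (simp add: mult.commute)
    also have "\<dots> = cnj (\<integral>w. w ^ m * cnj (w ^ n) \<partial>circle_measure)"
      by (rule Bochner_Integration.integral_cnj)
    finally show ?thesis using False ge[of n m] by simp
  qed (rule ge)
qed

lemma parseval_polynomial:
  fixes c :: "nat \<Rightarrow> complex"
  assumes "finite I"
  shows "(\<integral>w. (norm (\<Sum>n\<in>I. c n * w ^ n))\<^sup>2 \<partial>circle_measure) = 2 * pi * (\<Sum>n\<in>I. (norm (c n))\<^sup>2)"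
proof -
  have int: "integrable circle_measure (\<lambda>w. c n * cnj (c m) * (w ^ n * cnj (w ^ m)))" for n m
    by (intro continuous_circle_integrable continuous_intros)
  have "complex_of_real (\<integral>w. (norm (\<Sum>n\<in>I. c n * w ^ n))\<^sup>2 \<partial>circle_measure)
    = (\<integral>w. complex_of_real ((norm (\<Sum>n\<in>I. c n * w ^ n))\<^sup>2) \<partial>circle_measure)"
    by (rule integral_complex_of_real[symmetric])
  also have "\<dots> = (\<integral>w. (\<Sum>n\<in>I. \<Sum>m\<in>I. c n * cnj (c m) * (w ^ n * cnj (w ^ m))) \<partial>circle_measure)"
    unfolding complex_norm_square cnj_sum sum_product
    by (simp add: mult_ac)
  also have "\<dots> = (\<Sum>n\<in>I. \<Sum>m\<in>I. c n * cnj (c m) * (\<integral>w. w ^ n * cnj (w ^ m) \<partial>circle_measure))"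
    using int by (simp add: Bochner_Integration.integral_sum)
  also have "\<dots> = (\<Sum>n\<in>I. \<Sum>m\<in>I. if n = m then 2 * pi * (c n * cnj (c m)) else 0)"
    unfolding circle_integral_power_cnj by (intro sum.cong) auto
  also have "\<dots> = (\<Sum>n\<in>I. 2 * pi * (c n * cnj (c n)))"
    using assms by (simp add: sum.delta)
  also have "\<dots> = complex_of_real (2 * pi * (\<Sum>n\<in>I. (norm (c n))\<^sup>2))"
    by (simp add: complex_norm_square sum_distrib_left del: of_real_power)
  finally show ?thesis using of_real_eq_iff by blast
qed

lemma nn_integral_polynomial:
  fixes c :: "nat \<Rightarrow> complex"
  assumes "finite I"
  shows "(\<integral>\<^sup>+ w. (ennreal (norm (\<Sum>n\<in>I. c n * w ^ n)))\<^sup>2 \<partial>circle_measure)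
    = ennreal (2 * pi * (\<Sum>n\<in>I. (norm (c n))\<^sup>2))"
  unfolding parseval_polynomial[OF assms, symmetric]
  by (simp add: ennreal_power)
    (intro nn_integral_eq_integral continuous_circle_integrable continuous_intros AE_I2; simp)

definition taylor_coeff :: "(complex \<Rightarrow> complex) \<Rightarrow> nat \<Rightarrow> complex" where
  "taylor_coeff f n = (deriv ^^ n) f 0 / fact n"

lemma taylor_coeff_sums:
  assumes "f holomorphic_on ball 0 1" "norm z < 1"
  shows "(\<lambda>n. taylor_coeff f n * z ^ n) sums f z"
  using holomorphic_power_series[OF assms(1), of z] assms(2) by (simp add: taylor_coeff_def)

section \<open>Taylor coefficients and radial limits of a self-map\<close>

context
  fixes f :: "complex \<Rightarrow> complex"
  assumes f: "f holomorphic_on ball 0 1" and f1: "f ` ball 0 1 \<subseteq> ball 0 1"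
begin

lemma norm_self_map_less_one: "norm z < 1 \<Longrightarrow> norm (f z) < 1"
  using f1 by (auto simp: image_subset_iff)

text \<open>On a smaller circle the Taylor series converges absolutely, so Parseval's identity
  passes to the limit by dominated convergence, while the mean square of \<open>f\<close> there is
  at most 1.\<close>

lemma bessel_dilation:
  assumes \<sigma>: "0 \<le> \<sigma>" "\<sigma> < 1"
  shows "(\<Sum>n<M. (norm (taylor_coeff f n * of_real \<sigma> ^ n))\<^sup>2) \<le> 1"
proof -
  define c where "c = (\<lambda>n. taylor_coeff f n * of_real \<sigma> ^ n)"
  define S where "S = (\<lambda>M w. \<Sum>n<M. c n * w ^ n)"
  \<comment> \<open>A point of convergence strictly outside radius \<open>\<sigma>\<close>, as
    needed for absolute convergence at radius \<open>\<sigma>\<close>.\<close>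
  define x where "x = complex_of_real ((1 + \<sigma>) / 2)"
  have x: "norm x < 1" "norm (complex_of_real \<sigma>) < norm x"
    unfolding x_def norm_of_real using \<sigma> by auto
  have sum: "summable (\<lambda>n. norm (c n))"
    unfolding c_def
    by (rule powser_insidea[OF sums_summable[OF taylor_coeff_sums[OF f x(1)]] x(2)])
  define B where "B = (\<Sum>n. norm (c n))"
  have SB: "norm (S M w) \<le> B" if "norm w = 1" for M w
  proof -
    have "norm (S M w) \<le> (\<Sum>n<M. norm (c n))"
      unfolding S_def using that by (intro sum_norm_le) (simp add: norm_mult norm_power)
    also have "\<dots> \<le> B" unfolding B_def by (intro sum_le_suminf sum) auto
    finally show ?thesis .
  qed
  have lim: "(\<lambda>M. S M w) \<longlonglongrightarrow> f (of_real \<sigma> * w)" if "norm w = 1" for w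
    using taylor_coeff_sums[OF f, of "of_real \<sigma> * w"] that \<sigma>
    by (simp add: sums_def S_def c_def norm_mult power_mult_distrib mult_ac)
  have "(\<lambda>M. \<integral>w. (norm (S M w))\<^sup>2 \<partial>circle_measure) \<longlonglongrightarrow>
      (\<integral>w. (norm (f (of_real \<sigma> * w)))\<^sup>2 \<partial>circle_measure)"
  proof (rule integral_dominated_convergence[where w = "\<lambda>_. B\<^sup>2"])
    show "(\<lambda>w. (norm (f (of_real \<sigma> * w)))\<^sup>2) \<in> borel_measurable circle_measure"
      using measurable_dilation[OF f \<sigma>] by measurable
    show "(\<lambda>w. (norm (S M w))\<^sup>2) \<in> borel_measurable circle_measure" for M
      unfolding S_def by (intro continuous_circle_measurable continuous_intros)
    show "AE w in circle_measure. (\<lambda>M. (norm (S M w))\<^sup>2) \<longlonglongrightarrow> (norm (f (of_real \<sigma> * w)))\<^sup>2"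
      using AE_circle_norm by eventually_elim (intro tendsto_intros lim)
    show "AE w in circle_measure. norm ((norm (S M w))\<^sup>2) \<le> B\<^sup>2" for M
      using AE_circle_norm by eventually_elim (auto intro!: power_mono SB)
  qed simp
  then have lim2: "(\<lambda>M. 2 * pi * (\<Sum>n<M. (norm (c n))\<^sup>2)) \<longlonglongrightarrow>
      (\<integral>w. (norm (f (of_real \<sigma> * w)))\<^sup>2 \<partial>circle_measure)"
    unfolding S_def by (simp add: parseval_polynomial)
  have "2 * pi * (\<Sum>n<M. (norm (c n))\<^sup>2) \<le> (\<integral>w. (norm (f (of_real \<sigma> * w)))\<^sup>2 \<partial>circle_measure)"
    by (rule incseq_le[OF _ lim2]) (auto intro!: monoI mult_left_mono sum_mono2)
  also have "\<dots> \<le> (\<integral>w. 1 \<partial>circle_measure)"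
  proof (rule integral_mono_AE)
    show "integrable circle_measure (\<lambda>w. (norm (f (of_real \<sigma> * w)))\<^sup>2)"
      by (intro continuous_circle_integrable continuous_intros holomorphic_on_imp_continuous_on
          holomorphic_on_subset[OF holomorphic_on_dilation[OF f \<sigma>]]) auto
    show "AE w in circle_measure. (norm (f (of_real \<sigma> * w)))\<^sup>2 \<le> 1"
      using AE_circle_norm
    proof eventually_elim
      fix w :: complex assume "norm w = 1"
      then have "norm (f (of_real \<sigma> * w)) < 1" using \<sigma> by (intro norm_self_map_less_one) (simp add: norm_mult)
      then show "(norm (f (of_real \<sigma> * w)))\<^sup>2 \<le> 1" by (simp add: power_le_one)
    qed
  qed simp
  also have "\<dots> = 2 * pi"
    by (simp add: measure_def emeasure_space_circle)
  finally show ?thesis by (simp add: c_def)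
qed

text \<open>In a finite sum \<open>\<sigma>\<close> may tend to 1 term by term, and the bound 1 is
  independent of the number of terms.\<close>

lemma taylor_coeff_square_summable: "summable (\<lambda>n. (norm (taylor_coeff f n))\<^sup>2)"
proof (rule summableI_nonneg_bounded[where x = 1])
  fix M
  have "((\<lambda>\<sigma>. \<Sum>n<M. (norm (taylor_coeff f n * of_real \<sigma> ^ n))\<^sup>2) \<longlongrightarrow>
      (\<Sum>n<M. (norm (taylor_coeff f n * of_real 1 ^ n))\<^sup>2)) (at_left (1::real))"
    by (intro tendsto_intros)
  moreover have "eventually (\<lambda>\<sigma>. (\<Sum>n<M. (norm (taylor_coeff f n * of_real \<sigma> ^ n))\<^sup>2) \<le> 1) (at_left (1::real))"
    using eventually_at_left_real[of 0 "1::real"] by (auto elim!: eventually_mono intro: bessel_dilation)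
  ultimately show "(\<Sum>n<M. (norm (taylor_coeff f n))\<^sup>2) \<le> 1"
    by (intro tendsto_upperbound[of _ _ "at_left (1::real)"]) auto
qed simp

text \<open>This supplies the constant \<open>K\<close> of the maximal inequality for
  \<open>f\<close> minus a Taylor polynomial, uniformly in \<open>\<sigma>\<close>. An upper bound
  suffices, so Fatou's lemma is applied to the finite blocks of the tail.\<close>

lemma taylor_tail_bound:
  assumes \<sigma>: "0 \<le> \<sigma>" "\<sigma> < 1"
  shows "(\<integral>\<^sup>+ w. (ennreal (norm (f (of_real \<sigma> * w) - (\<Sum>n<N. taylor_coeff f n * (of_real \<sigma> * w) ^ n))))\<^sup>2
      \<partial>circle_measure) \<le> ennreal (2 * pi * (\<Sum>n. (norm (taylor_coeff f (n + N)))\<^sup>2))"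
proof -
  define c where "c = (\<lambda>n. taylor_coeff f n * of_real \<sigma> ^ n)"
  define S where "S = (\<lambda>M w. \<Sum>n=N..<M. c n * w ^ n)"
  define T where "T = (\<Sum>n. (norm (taylor_coeff f (n + N)))\<^sup>2)"
  define h where "h = (\<lambda>w. f (of_real \<sigma> * w) - (\<Sum>n<N. taylor_coeff f n * (of_real \<sigma> * w) ^ n))"
  have lim: "(\<lambda>M. S M w) \<longlonglongrightarrow> h w" if "norm w = 1" for w
  proof -
    have "(\<lambda>M. \<Sum>n<M. c n * w ^ n) \<longlonglongrightarrow> f (of_real \<sigma> * w)"
      using taylor_coeff_sums[OF f, of "of_real \<sigma> * w"] that \<sigma>
      by (simp add: sums_def c_def norm_mult power_mult_distrib mult_ac)
    then have "(\<lambda>M. (\<Sum>n<M. c n * w ^ n) - (\<Sum>n<N. c n * w ^ n)) \<longlonglongrightarrow> f (of_real \<sigma> * w) - (\<Sum>n<N. c n * w ^ n)"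
      by (intro tendsto_intros)
    moreover have "f (of_real \<sigma> * w) - (\<Sum>n<N. c n * w ^ n) = h w"
      by (simp add: h_def c_def power_mult_distrib mult_ac)
    moreover have "eventually (\<lambda>M. (\<Sum>n<M. c n * w ^ n) - (\<Sum>n<N. c n * w ^ n) = S M w) sequentially"
      using eventually_ge_at_top[of N]
    proof eventually_elim
      fix M assume "N \<le> M"
      then show "(\<Sum>n<M. c n * w ^ n) - (\<Sum>n<N. c n * w ^ n) = S M w"
        unfolding S_def by (simp add: lessThan_atLeast0 sum_diff_nat_ivl)
    qed
    ultimately show ?thesis
      using Lim_transform_eventually by fastforce
  qed
  have "(\<integral>\<^sup>+ w. (ennreal (norm (h w)))\<^sup>2 \<partial>circle_measure)
     = (\<integral>\<^sup>+ w. liminf (\<lambda>M. ennreal ((norm (S M w))\<^sup>2)) \<partial>circle_measure)"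
  proof (rule nn_integral_cong)
    fix w assume "w \<in> space circle_measure"
    then have "norm w = 1" by simp
    then have "(\<lambda>M. ennreal ((norm (S M w))\<^sup>2)) \<longlonglongrightarrow> ennreal ((norm (h w))\<^sup>2)"
      by (intro tendsto_intros lim)
    then have "liminf (\<lambda>M. ennreal ((norm (S M w))\<^sup>2)) = ennreal ((norm (h w))\<^sup>2)"
      by (rule lim_imp_Liminf[OF sequentially_bot])
    then show "(ennreal (norm (h w)))\<^sup>2 = liminf (\<lambda>M. ennreal ((norm (S M w))\<^sup>2))"
      by (simp add: ennreal_power)
  qed
  also have "\<dots> \<le> liminf (\<lambda>M. \<integral>\<^sup>+ w. ennreal ((norm (S M w))\<^sup>2) \<partial>circle_measure)"
    unfolding S_def
    by (intro nn_integral_liminf measurable_compose[OF _ measurable_ennreal]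
        continuous_circle_measurable continuous_intros)
  also have "\<dots> \<le> limsup (\<lambda>M. \<integral>\<^sup>+ w. ennreal ((norm (S M w))\<^sup>2) \<partial>circle_measure)"
    by (intro Liminf_le_Limsup) simp
  also have "\<dots> \<le> ennreal (2 * pi * T)"
  proof (intro Limsup_bounded always_eventually allI)
    fix M
    have "(\<integral>\<^sup>+ w. ennreal ((norm (S M w))\<^sup>2) \<partial>circle_measure) = ennreal (2 * pi * (\<Sum>n=N..<M. (norm (c n))\<^sup>2))"
      unfolding S_def using nn_integral_polynomial[of "{N..<M}" c] by (simp add: ennreal_power)
    also have "\<dots> \<le> ennreal (2 * pi * T)"
    proof (intro ennreal_leI mult_left_mono)
      have "(norm (c n))\<^sup>2 \<le> (norm (taylor_coeff f n))\<^sup>2" for n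
        unfolding c_def using \<sigma>
        by (intro power_mono) (auto simp: norm_mult norm_power mult_left_le power_le_one)
      then have "(\<Sum>n=N..<M. (norm (c n))\<^sup>2) \<le> (\<Sum>n=N..<M. (norm (taylor_coeff f n))\<^sup>2)"
        by (rule sum_mono)
      also have "\<dots> = (\<Sum>n<M-N. (norm (taylor_coeff f (n + N)))\<^sup>2)"
        using sum.shift_bounds_nat_ivl[of "\<lambda>n. (norm (taylor_coeff f n))\<^sup>2" 0 N "M - N"]
        by (cases "N \<le> M") (simp_all add: lessThan_atLeast0)
      also have "\<dots> \<le> T"
        unfolding T_def
        by (intro sum_le_suminf) (auto intro: summable_ignore_initial_segment[OF taylor_coeff_square_summable])
      finally show "(\<Sum>n=N..<M. (norm (c n))\<^sup>2) \<le> T" .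
    qed simp
    finally show "(\<integral>\<^sup>+ w. ennreal ((norm (S M w))\<^sup>2) \<partial>circle_measure) \<le> ennreal (2 * pi * T)" .
  qed
  finally show ?thesis by (simp add: T_def h_def)
qed

text \<open>Polynomials have radial limits everywhere, and the maximal functions of the remainders
  tend to 0 in mean. Where their infimum vanishes, \<open>f\<close> is a uniform limit of
  polynomials along the radius and is therefore Cauchy at the endpoint.\<close>

theorem AE_has_radial_limit: "AE \<zeta> in circle_measure. \<exists>l. has_radial_limit f \<zeta> l"
proof -
  define p where "p = (\<lambda>N z. \<Sum>n<N. taylor_coeff f n * z ^ n)"
  define h where "h = (\<lambda>N z. f z - p N z)"
  define T where "T = (\<lambda>N. \<Sum>n. (norm (taylor_coeff f (n + N)))\<^sup>2)"
  \<comment> \<open>Countably many radii keep the supremum measurable; continuity of the remainder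
    along the radius later extends the estimate from rational to all radii.\<close>
  define Q where "Q = {0..<1::real} \<inter> \<rat>"
  have cQ: "countable Q" unfolding Q_def by (intro countable_Int2 countable_rat)
  have "0 \<in> Q" by (simp add: Q_def)
  then have rangeQ: "range (from_nat_into Q) = Q" by (intro range_from_nat_into cQ) auto
  define q where "q = from_nat_into Q"
  have q: "0 \<le> q i" "q i < 1" for i
    using rangeQ by (auto simp: Q_def q_def)
  have holh: "h N holomorphic_on ball 0 1" for N
    unfolding h_def p_def by (intro holomorphic_intros f)
  define M where "M = (\<lambda>N \<zeta>. SUP i. (ennreal (norm (h N (of_real (q i) * \<zeta>))))\<^sup>2)"
  have [measurable]: "M N \<in> borel_measurable circle_measure" for N
    using measurable_dilation[OF holh q] unfolding M_def by measurable
  have MT: "(\<integral>\<^sup>+ \<zeta>. M N \<zeta> \<partial>circle_measure) \<le> ennreal (513 * (2 * pi * T N))" for N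
  proof -
    have "0 \<le> T N"
      unfolding T_def by (intro suminf_nonneg) (auto intro: summable_ignore_initial_segment[OF taylor_coeff_square_summable])
    have "(\<integral>\<^sup>+ \<zeta>. M N \<zeta> \<partial>circle_measure) \<le> 513 * ennreal (2 * pi * T N)"
      unfolding M_def T_def using holh q taylor_tail_bound
      by (intro radial_maximal_inequality) (auto simp: h_def p_def)
    also have "\<dots> = ennreal (513 * (2 * pi * T N))"
      using \<open>0 \<le> T N\<close> by (subst ennreal_mult) simp_all
    finally show ?thesis .
  qed
  have "T \<longlonglongrightarrow> (\<Sum>n. (norm (taylor_coeff f n))\<^sup>2) - (\<Sum>n. (norm (taylor_coeff f n))\<^sup>2)"
    unfolding T_def suminf_minus_initial_segment[OF taylor_coeff_square_summable]
    by (intro tendsto_intros summable_LIMSEQ taylor_coeff_square_summable)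
  then have "(\<lambda>N. 513 * (2 * pi * T N)) \<longlonglongrightarrow> 0"
    by (auto intro!: tendsto_eq_intros)
  then have T0: "(\<lambda>N. ennreal (513 * (2 * pi * T N))) \<longlonglongrightarrow> 0"
    by (metis ennreal_0 tendsto_ennrealI)
  \<comment> \<open>Taking the infimum over \<open>N\<close> avoids passing to an almost everywhere
    convergent subsequence.\<close>
  have "(\<integral>\<^sup>+ \<zeta>. (INF N. M N \<zeta>) \<partial>circle_measure) \<le> 0"
  proof (rule tendsto_lowerbound[OF T0])
    show "eventually (\<lambda>N. (\<integral>\<^sup>+ \<zeta>. (INF N. M N \<zeta>) \<partial>circle_measure) \<le> ennreal (513 * (2 * pi * T N))) sequentially"
      by (intro always_eventually allI order_trans[OF _ MT] nn_integral_mono INF_lower) auto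
  qed simp
  then have "AE \<zeta> in circle_measure. (INF N. M N \<zeta>) = 0"
    by (subst (asm) le_zero_eq, subst (asm) nn_integral_0_iff_AE) auto
  with AE_circle_norm show ?thesis
  proof eventually_elim
    fix \<zeta> :: complex assume \<zeta>: "norm \<zeta> = 1" and inf: "(INF N. M N \<zeta>) = 0"
    have approx: "\<exists>N. \<forall>r\<in>{0..<1}. norm (h N (of_real r * \<zeta>)) \<le> e" if e: "0 < e" for e
    proof -
      have "(INF N. M N \<zeta>) < (ennreal e)\<^sup>2" using inf e by (simp add: ennreal_power)
      then obtain N where N: "M N \<zeta> < (ennreal e)\<^sup>2" by (auto simp: INF_less_iff)
      have rat: "norm (h N (of_real s * \<zeta>)) \<le> e" if s: "s \<in> Q" for s
      proof -
        obtain i where i: "s = q i" using s rangeQ by (auto simp: q_def)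
        have "(ennreal (norm (h N (of_real (q i) * \<zeta>))))\<^sup>2 \<le> M N \<zeta>"
          unfolding M_def by (rule SUP_upper) simp
        also have "\<dots> \<le> (ennreal e)\<^sup>2" using N by simp
        finally have "ennreal (norm (h N (of_real (q i) * \<zeta>))) \<le> ennreal e"
          by (rule ennreal_power2_le_imp_le)
        then show ?thesis using e i by simp
      qed
      have cont: "continuous_on {0..<1} (\<lambda>s::real. norm (h N (of_real s * \<zeta>)))"
        using \<zeta> by (intro continuous_on_norm continuous_on_compose2[OF
            holomorphic_on_imp_continuous_on[OF holh[of N]]] continuous_intros)
          (auto simp: norm_mult)
      have "norm (h N (of_real r * \<zeta>)) \<le> e" if r: "r \<in> {0..<1}" for r
      proof (rule ccontr)
        assume "\<not> norm (h N (of_real r * \<zeta>)) \<le> e"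
        then have "0 < norm (h N (of_real r * \<zeta>)) - e" by simp
        then obtain d where d: "0 < d" and dd: "\<And>s. s \<in> {0..<1} \<Longrightarrow> dist s r < d \<Longrightarrow>
            dist (norm (h N (of_real s * \<zeta>))) (norm (h N (of_real r * \<zeta>))) < norm (h N (of_real r * \<zeta>)) - e"
          using cont r unfolding continuous_on_iff by meson
        obtain s where s: "s \<in> \<rat>" "r < s" "s < min 1 (r + d)"
          using Rats_dense_in_real[of r "min 1 (r + d)"] r d by auto
        then have "s \<in> Q" "dist s r < d" using r by (auto simp: Q_def dist_real_def)
        then show False
          using rat[of s] dd[of s] by (auto simp: Q_def dist_real_def)
      qed
      then show ?thesis by blast
    qed
    let ?g = "\<lambda>r::real. f (of_real r * \<zeta>)"
    have "cauchy_filter (filtermap ?g (at_left 1))"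
      unfolding cauchy_filter_metric_filtermap
    proof (intro allI impI)
      fix e :: real assume e: "0 < e"
      \<comment> \<open>One \<open>e / 5\<close> for the remainder and one for the polynomial give
        less than \<open>e / 2\<close> to a common centre, hence less than \<open>e\<close> between
        two points.\<close>
      obtain N where N: "\<And>r. r \<in> {0..<1} \<Longrightarrow> norm (h N (of_real r * \<zeta>)) \<le> e / 5"
        using approx[of "e / 5"] e by (meson divide_pos_pos zero_less_numeral)
      have "((\<lambda>r. p N (of_real r * \<zeta>)) \<longlongrightarrow> p N (of_real 1 * \<zeta>)) (at_left (1::real))"
        unfolding p_def by (intro tendsto_intros)
      then have "eventually (\<lambda>r. dist (p N (of_real r * \<zeta>)) (p N (of_real 1 * \<zeta>)) < e / 5) (at_left (1::real))"
        using e by (intro tendstoD) auto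
      moreover have "eventually (\<lambda>r. r \<in> {0<..<1}) (at_left (1::real))"
        by (rule eventually_at_left_real) simp
      ultimately have "eventually (\<lambda>r. dist (?g r) (p N (of_real 1 * \<zeta>)) < e / 2) (at_left (1::real))"
      proof eventually_elim
        fix r :: real
        assume a: "dist (p N (of_real r * \<zeta>)) (p N (of_real 1 * \<zeta>)) < e / 5" and "r \<in> {0<..<1}"
        then have "dist (?g r) (p N (of_real r * \<zeta>)) \<le> e / 5"
          using N[of r] by (simp add: dist_norm h_def)
        then show "dist (?g r) (p N (of_real 1 * \<zeta>)) < e / 2"
          using a e dist_triangle[of "?g r" "p N (of_real 1 * \<zeta>)" "p N (of_real r * \<zeta>)"] by linarith
      qed
      then show "\<exists>P. eventually P (at_left 1) \<and> (\<forall>x y. P x \<and> P y \<longrightarrow> dist (?g x) (?g y) < e)"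
        by (intro exI[of _ "\<lambda>r. dist (?g r) (p N (of_real 1 * \<zeta>)) < e / 2"]) (auto intro: dist_triangle_half_l)
    qed
    then obtain l where "filtermap ?g (at_left 1) \<le> nhds l"
      using cauchy_filter_complete_converges[of "filtermap ?g (at_left 1)" UNIV]
      by (auto simp: complete_UNIV filtermap_bot_iff)
    then show "\<exists>l. has_radial_limit f \<zeta> l"
      unfolding has_radial_limit_def filterlim_def by blast
  qed
qed

end

section \<open>Variance of the boundary values\<close>

text \<open>The decomposition of a mean square error into variance and squared bias, for the
  probability density \<open>poisson z\<close> under which \<open>g\<close> has mean
  \<open>g z\<close>. Taking \<open>c = g z\<close> gives the variance; other values of
  \<open>c\<close> serve to compare two interior points.\<close>

lemma poisson_variance:
  assumes g: "g holomorphic_on cball 0 1" and z: "norm z < 1"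
  shows "(\<integral>w. poisson z w * (norm (g w - c))\<^sup>2 \<partial>circle_measure)
    = (\<integral>w. poisson z w * (norm (g w))\<^sup>2 \<partial>circle_measure) - (norm (g z))\<^sup>2 + (norm (g z - c))\<^sup>2"
proof -
  have contg: "continuous_on (sphere 0 1) g"
    by (intro holomorphic_on_imp_continuous_on holomorphic_on_subset[OF g]) auto
  have expand: "(norm (x - c))\<^sup>2 = (norm x)\<^sup>2 - 2 * Re (x * cnj c) + (norm c)\<^sup>2" for x
    unfolding cmod_power2 by (simp add: power2_eq_square algebra_simps)
  have "(\<integral>w. poisson z w *\<^sub>R 1 \<partial>circle_measure) = (1::complex)"
    by (rule poisson_formula[OF holomorphic_on_const z])
  then have "complex_of_real (\<integral>w. poisson z w \<partial>circle_measure) = 1"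
    by (simp add: scaleR_conv_of_real)
  then have one: "(\<integral>w. poisson z w \<partial>circle_measure) = 1"
    using of_real_eq_1_iff by blast
  have intg: "integrable circle_measure (\<lambda>w. poisson z w *\<^sub>R (g w * cnj c))"
    by (intro continuous_circle_integrable continuous_intros continuous_poisson z contg)
  have "(\<integral>w. poisson z w *\<^sub>R (g w * cnj c) \<partial>circle_measure) = g z * cnj c"
    by (rule poisson_formula[OF _ z]) (intro holomorphic_intros g)
  then have lin: "(\<integral>w. poisson z w * Re (g w * cnj c) \<partial>circle_measure) = Re (g z * cnj c)"
    using integral_Re[OF intg] by simp
  have i: "integrable circle_measure (\<lambda>w. poisson z w * (norm (g w))\<^sup>2)"
      "integrable circle_measure (\<lambda>w. 2 * (poisson z w * Re (g w * cnj c)))"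
      "integrable circle_measure (\<lambda>w. poisson z w * (norm c)\<^sup>2)"
    by (intro continuous_circle_integrable continuous_intros continuous_poisson z contg)+
  have "(\<integral>w. poisson z w * (norm (g w - c))\<^sup>2 \<partial>circle_measure)
     = (\<integral>w. poisson z w * (norm (g w))\<^sup>2 - 2 * (poisson z w * Re (g w * cnj c))
         + poisson z w * (norm c)\<^sup>2 \<partial>circle_measure)"
    unfolding expand by (intro Bochner_Integration.integral_cong) (auto simp: algebra_simps)
  also have "\<dots> = (\<integral>w. poisson z w * (norm (g w))\<^sup>2 \<partial>circle_measure)
      - 2 * Re (g z * cnj c) + (norm c)\<^sup>2"
    using i by (simp only: Bochner_Integration.integral_add Bochner_Integration.integral_diff
        Bochner_Integration.integrable_diff integral_mult_right_zero integral_mult_left_zero lin one mult_1_left)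
  also have "\<dots> = (\<integral>w. poisson z w * (norm (g w))\<^sup>2 \<partial>circle_measure)
      - (norm (g z))\<^sup>2 + (norm (g z - c))\<^sup>2"
    unfolding expand by simp
  finally show ?thesis .
qed

lemma poisson_variance_le:
  assumes g: "g holomorphic_on cball 0 1" and g1: "\<And>w. norm w = 1 \<Longrightarrow> norm (g w) \<le> 1" and z: "norm z < 1"
  shows "(\<integral>w. poisson z w * (norm (g w - g z))\<^sup>2 \<partial>circle_measure) \<le> 1 - (norm (g z))\<^sup>2"
proof -
  have contg: "continuous_on (sphere 0 1) g"
    by (intro holomorphic_on_imp_continuous_on holomorphic_on_subset[OF g]) auto
  have "(\<integral>w. poisson z w * (norm (g w))\<^sup>2 \<partial>circle_measure) \<le> (\<integral>w. poisson z w \<partial>circle_measure)"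
  proof (rule integral_mono)
    show "poisson z w * (norm (g w))\<^sup>2 \<le> poisson z w" if "w \<in> space circle_measure" for w
      using that g1[of w] z by (intro mult_left_le) (auto simp: power_le_one poisson_nonneg)
  qed (intro continuous_circle_integrable continuous_intros continuous_poisson z contg)+
  also have "\<dots> = 1"
    using poisson_variance[OF holomorphic_on_const[of 1] z, of 0]
      poisson_formula[OF holomorphic_on_const[of 1] z]
    by (simp add: scaleR_conv_of_real)
  finally show ?thesis
    using poisson_variance[OF g z, of "g z"] by simp
qed

text \<open>The left side is the squared bias of \<open>g z0\<close> as a centre for the density at
  \<open>z\<close>. It is at most the mean square error there, which by Harnack is at most
  \<open>D\<close> times the variance at \<open>z0\<close>.\<close>

lemma dist_sq_le_defect_closed:
  assumes g: "g holomorphic_on cball 0 1" and g1: "\<And>w. norm w = 1 \<Longrightarrow> norm (g w) \<le> 1"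
    and z: "norm z < 1" and z0: "norm z0 < 1"
  shows "(norm (g z - g z0))\<^sup>2 \<le> (4 / ((1 - norm z)\<^sup>2 * (1 - (norm z0)\<^sup>2))) * (1 - (norm (g z0))\<^sup>2)"
proof -
  \<comment> \<open>The upper bound for the kernel at \<open>z\<close> divided by the lower bound
    for the kernel at \<open>z0\<close>; the 4 is \<open>8 * pi\<close> over
    \<open>2 * pi\<close>.\<close>
  define D where "D = 4 / ((1 - norm z)\<^sup>2 * (1 - (norm z0)\<^sup>2))"
  have z0': "0 < 1 - (norm z0)\<^sup>2" using z0 by (simp add: power_less_one_iff abs_square_less_1)
  have D: "0 \<le> D" unfolding D_def using z0' by simp
  have contg: "continuous_on (sphere 0 1) g"
    by (intro holomorphic_on_imp_continuous_on holomorphic_on_subset[OF g]) auto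
  have "poisson z w \<le> D * poisson z0 w" if w: "norm w = 1" for w
  proof -
    have "poisson z w \<le> 1 / (2 * pi * (1 - norm z)\<^sup>2)"
      using z w by (intro poisson_le) auto
    also have "\<dots> = D * ((1 - (norm z0)\<^sup>2) / (8 * pi))"
      unfolding D_def using z0' z by (simp add: field_simps)
    also have "\<dots> \<le> D * poisson z0 w"
      using D z0 w by (intro mult_left_mono poisson_ge) auto
    finally show ?thesis .
  qed
  then have "(\<integral>w. poisson z w * (norm (g w - g z0))\<^sup>2 \<partial>circle_measure)
     \<le> (\<integral>w. D * (poisson z0 w * (norm (g w - g z0))\<^sup>2) \<partial>circle_measure)"
    by (intro integral_mono continuous_circle_integrable continuous_intros continuous_poisson z z0 contg)
      (auto simp: mult.assoc[symmetric] intro!: mult_right_mono)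
  also have "\<dots> \<le> D * (1 - (norm (g z0))\<^sup>2)"
    using poisson_variance_le[OF g g1 z0] D by (simp add: mult_left_mono)
  finally have *: "(\<integral>w. poisson z w * (norm (g w - g z0))\<^sup>2 \<partial>circle_measure) \<le> D * (1 - (norm (g z0))\<^sup>2)" .
  have "0 \<le> (\<integral>w. poisson z w * (norm (g w - g z))\<^sup>2 \<partial>circle_measure)"
    using z by (intro integral_nonneg_AE AE_I2 mult_nonneg_nonneg) (auto simp: poisson_nonneg)
  then have "(norm (g z - g z0))\<^sup>2 \<le> (\<integral>w. poisson z w * (norm (g w - g z0))\<^sup>2 \<partial>circle_measure)"
    using poisson_variance[OF g z, of "g z0"] poisson_variance[OF g z, of "g z"] by simp
  with * show ?thesis by (simp add: D_def)
qed

section \<open>Passage to the open disc by dilation\<close>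

context
  fixes f :: "complex \<Rightarrow> complex"
  assumes f: "f holomorphic_on ball 0 1" and f1: "f ` ball 0 1 \<subseteq> ball 0 1"
begin

lemma norm_dilation_le: "norm w = 1 \<Longrightarrow> 0 \<le> \<sigma> \<Longrightarrow> \<sigma> < 1 \<Longrightarrow> norm (f (of_real \<sigma> * w)) \<le> 1"
  using norm_self_map_less_one[OF f f1, of "of_real \<sigma> * w"] by (simp add: norm_mult)

lemma radial_continuity:
  assumes z: "norm z < 1"
  shows "((\<lambda>\<sigma>::real. f (of_real \<sigma> * z)) \<longlongrightarrow> f z) (at_left 1)"
proof -
  have "isCont f z"
    using holomorphic_on_imp_continuous_on[OF f] z by (simp add: continuous_on_eq_continuous_at)
  moreover have "((\<lambda>\<sigma>::real. of_real \<sigma> * z) \<longlongrightarrow> z) (at_left 1)"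
    by (auto intro!: tendsto_eq_intros)
  ultimately show ?thesis by (rule isCont_tendsto_compose)
qed

lemma dist_sq_le_defect:
  assumes z: "norm z < 1" and z0: "norm z0 < 1"
  shows "(norm (f z - f z0))\<^sup>2 \<le> (4 / ((1 - norm z)\<^sup>2 * (1 - (norm z0)\<^sup>2))) * (1 - (norm (f z0))\<^sup>2)"
proof (rule tendsto_le)
  show "((\<lambda>\<sigma>::real. (norm (f (of_real \<sigma> * z) - f (of_real \<sigma> * z0)))\<^sup>2) \<longlongrightarrow> (norm (f z - f z0))\<^sup>2) (at_left 1)"
    by (intro tendsto_intros radial_continuity z z0)
  show "((\<lambda>\<sigma>::real. (4 / ((1 - norm z)\<^sup>2 * (1 - (norm z0)\<^sup>2))) * (1 - (norm (f (of_real \<sigma> * z0)))\<^sup>2)) \<longlongrightarrow>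
     (4 / ((1 - norm z)\<^sup>2 * (1 - (norm z0)\<^sup>2))) * (1 - (norm (f z0))\<^sup>2)) (at_left 1)"
    by (intro tendsto_intros radial_continuity z z0)
  have "eventually (\<lambda>\<sigma>. \<sigma> \<in> {0<..<1}) (at_left (1::real))"
    by (rule eventually_at_left_real) simp
  then show "eventually (\<lambda>\<sigma>::real. (norm (f (of_real \<sigma> * z) - f (of_real \<sigma> * z0)))\<^sup>2
     \<le> (4 / ((1 - norm z)\<^sup>2 * (1 - (norm z0)\<^sup>2))) * (1 - (norm (f (of_real \<sigma> * z0)))\<^sup>2)) (at_left 1)"
  proof eventually_elim
    fix \<sigma> :: real assume "\<sigma> \<in> {0<..<1}"
    then show "(norm (f (of_real \<sigma> * z) - f (of_real \<sigma> * z0)))\<^sup>2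
     \<le> (4 / ((1 - norm z)\<^sup>2 * (1 - (norm z0)\<^sup>2))) * (1 - (norm (f (of_real \<sigma> * z0)))\<^sup>2)"
      by (intro dist_sq_le_defect_closed[OF holomorphic_on_dilation[OF f] norm_dilation_le z z0]) auto
  qed
qed simp

text \<open>The lower limit along a sequence of dilations is measurable by construction, whether or
  not radial limits exist, and has the form to which Fatou's lemma applies. The centre is dilated as
  well, so that each term is the exact variance of one dilate.\<close>

lemma radial_liminf_variance:
  fixes \<sigma> :: "nat \<Rightarrow> real"
  assumes z: "norm z < 1" and \<sigma>: "\<And>k. 0 \<le> \<sigma> k" "\<And>k. \<sigma> k < 1" "\<sigma> \<longlonglongrightarrow> 1"
  shows "(\<integral>\<^sup>+ w. liminf (\<lambda>k. ennreal (poisson z w * (norm (f (of_real (\<sigma> k) * w) - f (of_real (\<sigma> k) * z)))\<^sup>2)) \<partial>circle_measure)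
     \<le> ennreal (1 - (norm (f z))\<^sup>2)"
proof -
  define G where "G = (\<lambda>k w. poisson z w * (norm (f (of_real (\<sigma> k) * w) - f (of_real (\<sigma> k) * z)))\<^sup>2)"
  have contG: "continuous_on (sphere 0 1) (G k)" for k
    unfolding G_def
    by (intro continuous_intros continuous_poisson z holomorphic_on_imp_continuous_on
        holomorphic_on_subset[OF holomorphic_on_dilation[OF f \<sigma>(1,2)]]) auto
  have "(\<integral>\<^sup>+ w. liminf (\<lambda>k. ennreal (G k w)) \<partial>circle_measure) \<le> liminf (\<lambda>k. \<integral>\<^sup>+ w. ennreal (G k w) \<partial>circle_measure)"
    by (intro nn_integral_liminf measurable_compose[OF _ measurable_ennreal] continuous_circle_measurable contG)
  also have "\<dots> \<le> liminf (\<lambda>k. ennreal (1 - (norm (f (of_real (\<sigma> k) * z)))\<^sup>2))"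
  proof (intro Liminf_mono always_eventually allI)
    fix k
    have "(\<integral>\<^sup>+ w. ennreal (G k w) \<partial>circle_measure) = ennreal (\<integral>w. G k w \<partial>circle_measure)"
      by (intro nn_integral_eq_integral continuous_circle_integrable contG AE_I2)
        (use z in \<open>simp add: G_def poisson_nonneg\<close>)
    also have "\<dots> \<le> ennreal (1 - (norm (f (of_real (\<sigma> k) * z)))\<^sup>2)"
      unfolding G_def
      using poisson_variance_le[OF holomorphic_on_dilation[OF f] norm_dilation_le z, of "\<sigma> k"] \<sigma>
      by (intro ennreal_leI) simp
    finally show "(\<integral>\<^sup>+ w. ennreal (G k w) \<partial>circle_measure) \<le> ennreal (1 - (norm (f (of_real (\<sigma> k) * z)))\<^sup>2)" .
  qed
  also have "\<dots> = ennreal (1 - (norm (f z))\<^sup>2)"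
  proof (rule lim_imp_Liminf[OF sequentially_bot])
    have "filterlim \<sigma> (at_left 1) sequentially"
      unfolding filterlim_at using \<sigma> by (auto intro!: always_eventually simp: less_imp_neq)
    from filterlim_compose[OF radial_continuity[OF z] this]
    show "(\<lambda>k. ennreal (1 - (norm (f (of_real (\<sigma> k) * z)))\<^sup>2)) \<longlonglongrightarrow> ennreal (1 - (norm (f z))\<^sup>2)"
      by (intro tendsto_intros)
  qed
  finally show ?thesis by (simp add: G_def)
qed

end

section \<open>Summing the variances and the Denjoy-Wolff set\<close>

lemma radial_limit_eq: "has_radial_limit f \<zeta> l \<Longrightarrow> radial_limit f \<zeta> = l"
  unfolding radial_limit_def has_radial_limit_def
  by (rule the_equality) (auto intro: tendsto_unique[OF trivial_limit_at_left_real])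

theorem theoremB:
  fixes F :: "nat \<Rightarrow> complex \<Rightarrow> complex" and z0 :: complex
  assumes "\<And>n. F n holomorphic_on ball 0 1"
    and "\<And>n. F n ` ball 0 1 \<subseteq> ball 0 1"
    and "z0 \<in> ball 0 1"
    and "summable (\<lambda>n. 1 - norm (F n z0))"
  shows "AE \<zeta> in circle_measure. \<zeta> \<in> denjoy_wolff_set F"
proof -
  have z0: "norm z0 < 1" using assms(3) by simp
  have F1: "norm (F n z) < 1" if "norm z < 1" for n z
    using norm_self_map_less_one[OF assms(1,2) that] .
  have defect_le: "1 - (norm (F n z0))\<^sup>2 \<le> 2 * (1 - norm (F n z0))" for n
  proof -
    have "0 \<le> (1 - norm (F n z0))\<^sup>2" by simp
    then show ?thesis by (simp add: power2_eq_square algebra_simps)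
  qed
  have defect_nonneg: "0 \<le> 1 - (norm (F n z0))\<^sup>2" for n
    using F1[OF z0, of n] by (simp add: power_le_one)
  have sum: "summable (\<lambda>n. 1 - (norm (F n z0))\<^sup>2)"
    using defect_le defect_nonneg
    by (intro summable_comparison_test'[OF summable_mult[OF assms(4), of 2], of 0]) simp
  have conv: "(\<lambda>n. F n z - F n z0) \<longlonglongrightarrow> 0" if z: "norm z < 1" for z
  proof -
    have "(\<lambda>n. (norm (F n z - F n z0))\<^sup>2) \<longlonglongrightarrow> 0"
    proof (rule tendsto_sandwich[where f = "\<lambda>_. 0"])
      show "(\<lambda>n. (4 / ((1 - norm z)\<^sup>2 * (1 - (norm z0)\<^sup>2))) * (1 - (norm (F n z0))\<^sup>2)) \<longlonglongrightarrow> 0"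
        using tendsto_mult_right_zero[OF summable_LIMSEQ_zero[OF sum]] .
      show "eventually (\<lambda>n. (norm (F n z - F n z0))\<^sup>2
          \<le> (4 / ((1 - norm z)\<^sup>2 * (1 - (norm z0)\<^sup>2))) * (1 - (norm (F n z0))\<^sup>2)) sequentially"
        using dist_sq_le_defect[OF assms(1,2) z z0] by (intro always_eventually allI)
    qed auto
    then show ?thesis
      by (simp add: tendsto_norm_zero_iff)
  qed
  have norm0: "(\<lambda>n. norm (F n z0)) \<longlonglongrightarrow> 1"
    using tendsto_diff[OF tendsto_const[of 1] summable_LIMSEQ_zero[OF assms(4)]] by simp
  have boundary: "tends_to_boundary F"
    unfolding tends_to_boundary_def
  proof
    fix z :: complex assume "z \<in> ball 0 1"
    then have z: "norm z < 1" by simp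
    show "(\<lambda>n. infdist (F n z) (sphere 0 1)) \<longlonglongrightarrow> 0"
    proof (rule tendsto_sandwich[where f = "\<lambda>_. 0"])
      have "infdist (F n z) (sphere 0 1) \<le> (1 - norm (F n z0)) + norm (F n z - F n z0)" for n
      proof -
        \<comment> \<open>A nearest point of the circle. The centre needs a separate choice because
          \<open>sgn 0 = 0\<close> is not on the circle.\<close>
        define u where "u = (if F n z = 0 then 1 else sgn (F n z))"
        have u: "norm u = 1" by (simp add: u_def norm_sgn)
        have "F n z - u = of_real (norm (F n z) - 1) * u"
          by (auto simp: u_def sgn_eq algebra_simps)
        then have "dist (F n z) u = 1 - norm (F n z)"
          using F1[OF z, of n] u
          by (simp only: dist_norm norm_mult norm_of_real) simp
        moreover have "infdist (F n z) (sphere 0 1) \<le> dist (F n z) u"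
          using u by (intro infdist_le) simp
        ultimately show ?thesis
          using norm_triangle_ineq2[of "F n z0" "F n z"] by (simp add: norm_minus_commute)
      qed
      then show "eventually (\<lambda>n. infdist (F n z) (sphere 0 1)
          \<le> (1 - norm (F n z0)) + norm (F n z - F n z0)) sequentially"
        by simp
      show "(\<lambda>n. (1 - norm (F n z0)) + norm (F n z - F n z0)) \<longlonglongrightarrow> 0"
        using tendsto_add[OF summable_LIMSEQ_zero[OF assms(4)] tendsto_norm_zero[OF conv[OF z]]] by simp
    qed (auto simp: infdist_nonneg)
  qed
  \<comment> \<open>One sequence of radii is enough, since at almost every point the full radial
    limits exist and are reached along it.\<close>
  define \<sigma> where "\<sigma> = (\<lambda>k. 1 - 1 / real (Suc k))"
  have \<sigma>: "0 \<le> \<sigma> k" "\<sigma> k < 1" for k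
    by (auto simp: \<sigma>_def field_simps)
  have \<sigma>lim: "\<sigma> \<longlonglongrightarrow> 1"
    unfolding \<sigma>_def
    using tendsto_diff[OF tendsto_const[of 1] LIMSEQ_inverse_real_of_nat] by (simp add: inverse_eq_divide)
  have \<sigma>left: "filterlim \<sigma> (at_left 1) sequentially"
    unfolding filterlim_at using \<sigma> \<sigma>lim by (auto intro!: always_eventually simp: less_imp_neq)
  define G where "G = (\<lambda>n w. liminf (\<lambda>k. ennreal (poisson z0 w *
      (norm (F n (of_real (\<sigma> k) * w) - F n (of_real (\<sigma> k) * z0)))\<^sup>2)))"
  have [measurable]: "G n \<in> borel_measurable circle_measure" for n
    unfolding G_def
    by (intro borel_measurable_liminf measurable_compose[OF _ measurable_ennreal] continuous_circle_measurable
        continuous_intros continuous_poisson z0 holomorphic_on_imp_continuous_on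
        holomorphic_on_subset[OF holomorphic_on_dilation[OF assms(1) \<sigma>]]) auto
  have "(\<integral>\<^sup>+ w. (\<Sum>n. G n w) \<partial>circle_measure) = (\<Sum>n. \<integral>\<^sup>+ w. G n w \<partial>circle_measure)"
    by (rule nn_integral_suminf) measurable
  also have "\<dots> \<le> (\<Sum>n. ennreal (1 - (norm (F n z0))\<^sup>2))"
    unfolding G_def by (intro suminf_le radial_liminf_variance assms z0 \<sigma> \<sigma>lim summableI)
  also have "\<dots> = ennreal (\<Sum>n. 1 - (norm (F n z0))\<^sup>2)"
    by (rule suminf_ennreal2[OF defect_nonneg sum])
  finally have "(\<integral>\<^sup>+ w. (\<Sum>n. G n w) \<partial>circle_measure) \<noteq> \<infinity>"
    by (auto simp: top_unique)
  then have "AE w in circle_measure. (\<Sum>n. G n w) \<noteq> \<infinity>"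
    by (intro nn_integral_PInf_AE) auto
  moreover have "AE w in circle_measure. \<forall>n. \<exists>l. has_radial_limit (F n) w l"
    unfolding AE_all_countable using AE_has_radial_limit[OF assms(1,2)] by blast
  ultimately show ?thesis
    using AE_circle_norm
  proof eventually_elim
    fix \<zeta> :: complex
    assume fin: "(\<Sum>n. G n \<zeta>) \<noteq> \<infinity>" and ex: "\<forall>n. \<exists>l. has_radial_limit (F n) \<zeta> l" and \<zeta>: "norm \<zeta> = 1"
    define L where "L = (\<lambda>n. radial_limit (F n) \<zeta>)"
    have L: "has_radial_limit (F n) \<zeta> (L n)" for n
      using ex radial_limit_eq unfolding L_def by metis
    have G: "G n \<zeta> = ennreal (poisson z0 \<zeta> * (norm (L n - F n z0))\<^sup>2)" for n
      unfolding G_def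
    proof (rule lim_imp_Liminf[OF sequentially_bot])
      have "(\<lambda>k. F n (of_real (\<sigma> k) * \<zeta>)) \<longlonglongrightarrow> L n"
        using filterlim_compose[OF L[unfolded has_radial_limit_def] \<sigma>left] .
      moreover have "(\<lambda>k. F n (of_real (\<sigma> k) * z0)) \<longlonglongrightarrow> F n z0"
        using filterlim_compose[OF radial_continuity[OF assms(1,2) z0] \<sigma>left] .
      ultimately show "(\<lambda>k. ennreal (poisson z0 \<zeta> *
          (norm (F n (of_real (\<sigma> k) * \<zeta>) - F n (of_real (\<sigma> k) * z0)))\<^sup>2))
          \<longlonglongrightarrow> ennreal (poisson z0 \<zeta> * (norm (L n - F n z0))\<^sup>2)"
        by (intro tendsto_intros)
    qed
    \<comment> \<open>A positive weight at \<open>\<zeta>\<close> may be divided out of the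
      convergent series.\<close>
    have pos: "0 < poisson z0 \<zeta>"
    proof -
      have "0 < (1 - (norm z0)\<^sup>2) / (8 * pi)" using z0 by (simp add: power_less_one_iff abs_square_less_1)
      then show ?thesis using poisson_ge[OF z0 \<zeta>] by linarith
    qed
    have "summable (\<lambda>n. poisson z0 \<zeta> * (norm (L n - F n z0))\<^sup>2)"
      using fin pos unfolding G by (intro summable_suminf_not_top) auto
    then have "(\<lambda>n. (norm (L n - F n z0))\<^sup>2) \<longlonglongrightarrow> 0"
      using pos summable_LIMSEQ_zero by (force simp: summable_cmult_iff)
    then have lim0: "(\<lambda>n. L n - F n z0) \<longlonglongrightarrow> 0"
      by (simp add: tendsto_norm_zero_iff)
    \<comment> \<open>The exceptional null set depends on \<open>z0\<close> alone: the point
      \<open>z\<close> enters through \<open>conv\<close>, which holds without exception and does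
      not involve \<open>\<zeta>\<close>. This allows the quantifier over the uncountably many
      \<open>z\<close> inside the almost everywhere statement.\<close>
    have "(\<lambda>n. norm (L n - F n z)) \<longlonglongrightarrow> 0" if "norm z < 1" for z
      using tendsto_norm_zero[OF tendsto_diff[OF lim0 conv[OF that], simplified]] by simp
    then show "\<zeta> \<in> denjoy_wolff_set F"
      using \<zeta> boundary ex by (auto simp: denjoy_wolff_set_def L_def)
  qed
qed

end
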